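(* Consider the freight marketplace, its $\theta$-scaled instances, the fluid problem and the static posted price mechanism $\mathsf{SP}$ described in the context. The static posted price mechanism $(\mathbf r^*,\mathbf p^* )$ is asymptotically optimal. More specifically, $$\gamma^{\mathsf{FA}}(\theta)-\gamma^{\mathsf{SP}}(\theta)\le O(\sqrt\theta),$$ and therefore $\gamma^{\mathsf{SP}}(\theta)/\gamma^{\mathsf{FA}}(\theta)=1-O(1/\sqrt\theta)\to1$ as the scaling factor $\theta$ approaches infinity.
   Context: Network and dynamics. $\mathcal N=\{1,\dots,n\}$ is a set of nodes and $\mathcal E\subseteq\mathcal N\times\mathcal N$ a set of lanes, containing all self-loops; $\delta^+(j)=\{k:(j,k)\in\mathcal E\}$, $\delta^-(j)=\{i:(i,j)\in\mathcal E\}$. Time is discrete. At the beginning of period $t$ there are $S_{it}$ carriers available at node $i$ and $D_{ijt}$ loads on lane $(i,j)$. Under shipper prices $r_{ijt}$ in period $t$, $D_{ij,t+1}$ is Poisson with mean $d_{ij}(r_{ijt})$, where $d_{ij}(\cdot)$ is strictly decreasing with inverse $r_{ij}(\cdot)$ and $d\mapsto r_{ij}(d)d$ is concave. Each carrier transports at most one load per period and each trip takes one period. $Y_{ijt}\le D_{ijt}$ is the number of carriers transporting a load on $(i,j)$; all other carriers at node $i$, numbering $V_{it}=S_{it}-\sum_{j\in\delta^+(i)}Y_{ijt}$, leave the marketplace. Given $Y_{ijt}$, the number $Z_{ijt}$ of carriers who stay (at node $j$) is Binomial$(Y_{ijt},q_{ij})$ with $q_{ij}\in(0,1)$, and $S_{j,t+1}=\sum_{i\in\delta^-(j)}Z_{ijt}+\Lambda_{j,t+1}$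 with $\Lambda_{j,t+1}$ Poisson of rate $\lambda_j>0$. Unmatched loads expire at unit penalty cost $b_{ij}$. With $P_{ijt}$ the total payment to carriers on lane $(i,j)$, the expected period profit is $\mathrm E[\sum_{(i,j)\in\mathcal E}r_{ijt}d_{ij}(r_{ijt})-b_{ij}(D_{ijt}-Y_{ijt})-P_{ijt}]$, and the long-run average profit is the limit of its time averages. Carrier choice. A carrier $s$ at node $i$ paid $p$ for a load on $(i,j)$ has utility $\beta p-\alpha_{ij}+\epsilon^s_{ijt}$, and $\epsilon^s_{i0t}$ for the outside option (leaving), with $\beta>0$, $\alpha_{ij}>0$ and all $\epsilon$'s i.i.d. Gumbel (location 0, scale 1). Fluid problem: $$(\mathsf{FA}):\ \max_{\mathbf d,\bar{\mathbf y},\bar{\mathbf v}}\ \sum_{(i,j)\in\mathcal E}r_{ij}(d_{ij})d_{ij}-\frac1\beta\Big[\ln\Big(\frac{\bar y_{ij}}{\bar v_i}\Big)+\alpha_{ij}\Big]\bar y_{ij}-b_{ij}(d_{ij}-\bar y_{ij})$$ subject to $\sum_{i\in\delta^-(j)}q_{ij}\bar y_{ij}+\lambda_j=\sum_{k\in\delta^+(j)}\bar y_{jk}+\bar v_j$ for all $j\in\mathcal N$; $0\le\bar y_{ij}\le d_{ij}$ for all $(i,j)\in\mathcal E$; $\bar v_i\ge0$ for all $i\in\mathcal N$. Let $(\mathbf d^*,\bar{\mathbf y}^*,\bar{\mathbf v}^* )$ be an optimal solution, $\gamma^{\mathsf{FA}}$ the optimal value, $r^*_{ij}=r_{ij}(d^*_{ij})$,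 and $p^*_{ij}=\frac1\beta[\ln(\bar y^*_{ij}/\bar v^*_i)+\alpha_{ij}]$. Standing assumption: $\gamma^{\mathsf{FA}}>0$. Scaling. For $\theta\in\{1,2,\dots\}$, the $\theta$-scaled instance has shipper demand rates $\theta\mathbf d$ (demand functions $\theta d_{ij}(\cdot)$) and carrier arrival rates $\theta\boldsymbol\lambda$, all other parameters unchanged. Its fluid problem has optimal solution $(\theta\mathbf d^*,\theta\bar{\mathbf y}^*,\theta\bar{\mathbf v}^* )$ and optimal value $\gamma^{\mathsf{FA}}(\theta)=\theta\gamma^{\mathsf{FA}}$. Mechanism $\mathsf{SP}$. In all states and periods (and for every $\theta$) the platform charges shippers $\mathbf r^*$ and offers carriers $\mathbf p^*$. In each period carriers at node $i$ arrive sequentially; when the $s$-th carrier arrives, he chooses the utility-maximizing option among the lanes $(i,j)$ that still have unbooked loads and the outside option. That is, with $\delta^{[s]+}_t(i)$ the set of destinations $j$ with remaining loads, he books lane $(i,j)$, $j\in\delta^{[s]+}_t(i)$, with probability $e^{\beta p^*_{ij}-\alpha_{ij}}/(1+\sum_{k\in\delta^{[s]+}_t(i)}e^{\beta p^*_{ik}-\alpha_{ik}})$ and otherwise leaves. Each booked carrier on $(i,j)$ is paid $p^*_{ij}$. $\gamma^{\mathsf{SP}}(\theta)$ is the long-run average profit of $\mathsf{SP}$ in the $\theta$-scaled instance. Notation: $f(\theta)\le O(\sqrt\theta)$ means that there is a constant $K$ independent of $\theta$ with $f(\theta)\le K\sqrt\theta$. *)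

theory Defs
  imports "HOL-Probability.Probability" "HOL-Library.Landau_Symbols"
begin

text \<open>
  Nodes are the elements of a finite type and lane-indexed quantities are functions on pairs
  of nodes, of which only the values on \<open>lanes M\<close> matter. The prices that may be charged on a
  lane form an explicit set \<open>prices M e\<close>, so that demand functions that are only decreasing and
  nonnegative on part of the real line (linear demand, say) are covered.
\<close>

record 'n market =
  lanes :: "('n \<times> 'n) set"
  prices :: "'n \<times> 'n \<Rightarrow> real set"
  demand :: "'n \<times> 'n \<Rightarrow> real \<Rightarrow> real"
  penalty :: "'n \<times> 'n \<Rightarrow> real"
  stay_prob :: "'n \<times> 'n \<Rightarrow> real"
  arrival_rate :: "'n \<Rightarrow> real"
  disutility :: "'n \<times> 'n \<Rightarrow> real"
  sensitivity :: real

definition out_nbrs :: "'n market \<Rightarrow> 'n \<Rightarrow> 'n set" where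
  "out_nbrs M j = {k. (j, k) \<in> lanes M}"

definition in_nbrs :: "'n market \<Rightarrow> 'n \<Rightarrow> 'n set" where
  "in_nbrs M j = {i. (i, j) \<in> lanes M}"

definition demand_range :: "'n market \<Rightarrow> 'n \<times> 'n \<Rightarrow> real set" where
  "demand_range M e = demand M e ` prices M e"

definition inverse_demand :: "'n market \<Rightarrow> 'n \<times> 'n \<Rightarrow> real \<Rightarrow> real" where
  "inverse_demand M e = the_inv_into (prices M e) (demand M e)"

definition freight_market :: "'n market \<Rightarrow> bool" where
  "freight_market M \<longleftrightarrow>
     (\<forall>i. (i, i) \<in> lanes M) \<and>
     (\<forall>e\<in>lanes M. strict_antimono_on (prices M e) (demand M e) \<and>
        (\<forall>r\<in>prices M e. 0 \<le> demand M e r) \<and>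
        concave_on (demand_range M e) (\<lambda>d. inverse_demand M e d * d)) \<and>
     (\<forall>e\<in>lanes M. 0 < stay_prob M e \<and> stay_prob M e < 1) \<and>
     (\<forall>i. 0 < arrival_rate M i) \<and>
     (\<forall>e\<in>lanes M. 0 < disutility M e) \<and>
     0 < sensitivity M"

definition scale :: "nat \<Rightarrow> 'n market \<Rightarrow> 'n market" where
  "scale \<theta> M = M\<lparr>demand := (\<lambda>e r. real \<theta> * demand M e r),
                   arrival_rate := (\<lambda>i. real \<theta> * arrival_rate M i)\<rparr>"


section \<open>Fluid problem\<close>

definition fluid_carrier_price ::
  "'n market \<Rightarrow> ('n \<times> 'n \<Rightarrow> real) \<Rightarrow> ('n \<Rightarrow> real) \<Rightarrow> 'n \<times> 'n \<Rightarrow> real" where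
  "fluid_carrier_price M y v = (\<lambda>(i, j).
     1 / sensitivity M * (ln (y (i, j) / v i) + disutility M (i, j)))"

text \<open>
  Serving a positive flow out of a node that no carrier leaves, \<open>v i = 0 < y (i, j)\<close>, has
  infinite cost because \<open>ln (y / v)\<close> tends to infinity as \<open>v\<close> tends to zero. This has to be said
  explicitly because \<open>x / 0 = 0\<close> and \<open>ln 0 = 0\<close> in HOL. For \<open>y = 0\<close> the carrier payment is zero,
  in accordance with the limit of \<open>y * ln y\<close>.
\<close>

definition fluid_objective ::
  "'n market \<Rightarrow> ('n \<times> 'n \<Rightarrow> real) \<Rightarrow> ('n \<times> 'n \<Rightarrow> real) \<Rightarrow> ('n \<Rightarrow> real) \<Rightarrow> ereal" where
  "fluid_objective M d y v = (\<Sum>(i, j)\<in>lanes M.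
     if v i = 0 \<and> 0 < y (i, j) then - \<infinity>
     else ereal (inverse_demand M (i, j) (d (i, j)) * d (i, j)
            - fluid_carrier_price M y v (i, j) * y (i, j)
            - penalty M (i, j) * (d (i, j) - y (i, j))))"

definition fluid_feasible ::
  "'n market \<Rightarrow> ('n \<times> 'n \<Rightarrow> real) \<Rightarrow> ('n \<times> 'n \<Rightarrow> real) \<Rightarrow> ('n \<Rightarrow> real) \<Rightarrow> bool" where
  "fluid_feasible M d y v \<longleftrightarrow>
     (\<forall>j. (\<Sum>i\<in>in_nbrs M j. stay_prob M (i, j) * y (i, j)) + arrival_rate M j
            = (\<Sum>k\<in>out_nbrs M j. y (j, k)) + v j) \<and>
     (\<forall>e\<in>lanes M. d e \<in> demand_range M e \<and> 0 \<le> y e \<and> y e \<le> d e) \<and>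
     (\<forall>i. 0 \<le> v i)"

definition fluid_optimal ::
  "'n market \<Rightarrow> ('n \<times> 'n \<Rightarrow> real) \<Rightarrow> ('n \<times> 'n \<Rightarrow> real) \<Rightarrow> ('n \<Rightarrow> real) \<Rightarrow> bool" where
  "fluid_optimal M d y v \<longleftrightarrow> fluid_feasible M d y v \<and>
     (\<forall>d' y' v'. fluid_feasible M d' y' v' \<longrightarrow>
        fluid_objective M d' y' v' \<le> fluid_objective M d y v)"

definition gamma_FA :: "'n market \<Rightarrow> real" where
  "gamma_FA M = real_of_ereal
     (SUP (d, y, v)\<in>{(d, y, v). fluid_feasible M d y v}. fluid_objective M d y v)"


section \<open>Stochastic dynamics under static posted prices\<close>

text \<open>
  The choice \<open>None\<close> is the outside option; \<open>A\<close> is the set of destinations with remaining loads.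
\<close>

definition choice_pmf ::
  "'n market \<Rightarrow> ('n \<times> 'n \<Rightarrow> real) \<Rightarrow> 'n \<Rightarrow> 'n set \<Rightarrow> 'n option pmf" where
  "choice_pmf M p i A =
     (let w = (\<lambda>j. exp (sensitivity M * p (i, j) - disutility M (i, j)));
          W = 1 + (\<Sum>k\<in>A. w k)
      in embed_pmf (\<lambda>c. case c of None \<Rightarrow> 1 / W
                                 | Some j \<Rightarrow> if j \<in> A then w j / W else 0))"

text \<open>
  The number of loads booked to each destination after \<open>s\<close> carriers at node \<open>i\<close> have chosen.
\<close>

primrec node_bookings ::
  "'n market \<Rightarrow> ('n \<times> 'n \<Rightarrow> real) \<Rightarrow> ('n \<times> 'n \<Rightarrow> nat) \<Rightarrow> 'n \<Rightarrow> nat \<Rightarrow> ('n \<Rightarrow> nat) pmf" where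
  "node_bookings M p D i 0 = return_pmf (\<lambda>j. 0)"
| "node_bookings M p D i (Suc s) =
     bind_pmf (node_bookings M p D i s) (\<lambda>Y.
       map_pmf (\<lambda>c. case c of None \<Rightarrow> Y | Some j \<Rightarrow> Y(j := Suc (Y j)))
         (choice_pmf M p i {j \<in> out_nbrs M i. Y j < D (i, j)}))"

definition bookings ::
  "'n::finite market \<Rightarrow> ('n \<times> 'n \<Rightarrow> real) \<Rightarrow> ('n \<Rightarrow> nat) \<Rightarrow> ('n \<times> 'n \<Rightarrow> nat) \<Rightarrow>
     ('n \<times> 'n \<Rightarrow> nat) pmf" where
  "bookings M p S D =
     map_pmf (\<lambda>Y (i, j). Y i j) (Pi_pmf UNIV (\<lambda>_. 0) (\<lambda>i. node_bookings M p D i (S i)))"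

text \<open>
  A state \<open>(S, D)\<close> holds the available carriers at each node and the loads on each lane.
\<close>

type_synonym 'n state = "('n \<Rightarrow> nat) \<times> ('n \<times> 'n \<Rightarrow> nat)"

text \<open>
  The library leaves \<^const>\<open>poisson_pmf\<close> unspecified at rate zero, which a demand function may
  attain.
\<close>

definition poisson_dist :: "real \<Rightarrow> nat pmf" where
  "poisson_dist \<mu> = (if \<mu> = 0 then return_pmf 0 else poisson_pmf \<mu>)"

definition transition ::
  "'n::finite market \<Rightarrow> ('n \<times> 'n \<Rightarrow> real) \<Rightarrow> ('n \<times> 'n \<Rightarrow> real) \<Rightarrow> 'n state \<Rightarrow> 'n state pmf" where
  "transition M r p = (\<lambda>(S, D).
     bind_pmf (bookings M p S D) (\<lambda>Y.
     bind_pmf (Pi_pmf (lanes M) 0 (\<lambda>e. binomial_pmf (Y e) (stay_prob M e))) (\<lambda>Z.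
     bind_pmf (Pi_pmf UNIV 0 (\<lambda>j. poisson_dist (arrival_rate M j))) (\<lambda>L.
     bind_pmf (Pi_pmf (lanes M) 0 (\<lambda>e. poisson_dist (demand M e (r e)))) (\<lambda>D'.
     return_pmf (\<lambda>j. (\<Sum>i\<in>in_nbrs M j. Z (i, j)) + L j, D'))))))"

primrec state_pmf ::
  "'n::finite market \<Rightarrow> ('n \<times> 'n \<Rightarrow> real) \<Rightarrow> ('n \<times> 'n \<Rightarrow> real) \<Rightarrow> 'n state \<Rightarrow> nat \<Rightarrow>
     'n state pmf" where
  "state_pmf M r p x 0 = return_pmf x"
| "state_pmf M r p x (Suc t) = bind_pmf (state_pmf M r p x t) (transition M r p)"

definition period_profit ::
  "'n::finite market \<Rightarrow> ('n \<times> 'n \<Rightarrow> real) \<Rightarrow> ('n \<times> 'n \<Rightarrow> real) \<Rightarrow> 'n state \<Rightarrow> real" where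
  "period_profit M r p = (\<lambda>(S, D).
     measure_pmf.expectation (bookings M p S D) (\<lambda>Y.
       \<Sum>e\<in>lanes M. r e * demand M e (r e)
          - penalty M e * (real (D e) - real (Y e)) - p e * real (Y e)))"

definition average_profit ::
  "'n::finite market \<Rightarrow> ('n \<times> 'n \<Rightarrow> real) \<Rightarrow> ('n \<times> 'n \<Rightarrow> real) \<Rightarrow> 'n state \<Rightarrow> nat \<Rightarrow> real" where
  "average_profit M r p x T =
     (\<Sum>t<T. measure_pmf.expectation (state_pmf M r p x t) (period_profit M r p)) / real T"

definition long_run_profit ::
  "'n::finite market \<Rightarrow> ('n \<times> 'n \<Rightarrow> real) \<Rightarrow> ('n \<times> 'n \<Rightarrow> real) \<Rightarrow> real" where
  "long_run_profit M r p = (THE g. \<forall>x. average_profit M r p x \<longlonglongrightarrow> g)"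

text \<open>
  The prices of the mechanism come from a solution of the unscaled fluid problem. The carrier
  price is meaningless if \<open>y e = 0\<close>; at a solution of positive value this occurs only if \<open>d e = 0\<close>,
  and then no load ever appears on \<open>e\<close> after the initial period.
\<close>

definition SP_shipper_price ::
  "'n market \<Rightarrow> ('n \<times> 'n \<Rightarrow> real) \<Rightarrow> 'n \<times> 'n \<Rightarrow> real" where
  "SP_shipper_price M d e = inverse_demand M e (d e)"

definition SP_average_profit ::
  "'n::finite market \<Rightarrow> ('n \<times> 'n \<Rightarrow> real) \<Rightarrow> ('n \<times> 'n \<Rightarrow> real) \<Rightarrow> ('n \<Rightarrow> real) \<Rightarrow> nat \<Rightarrow>
     'n state \<Rightarrow> nat \<Rightarrow> real" where
  "SP_average_profit M d y v \<theta> =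
     average_profit (scale \<theta> M) (SP_shipper_price M d) (fluid_carrier_price M y v)"

definition gamma_SP ::
  "'n::finite market \<Rightarrow> ('n \<times> 'n \<Rightarrow> real) \<Rightarrow> ('n \<times> 'n \<Rightarrow> real) \<Rightarrow> ('n \<Rightarrow> real) \<Rightarrow> nat \<Rightarrow> real" where
  "gamma_SP M d y v \<theta> =
     long_run_profit (scale \<theta> M) (SP_shipper_price M d) (fluid_carrier_price M y v)"

end

theory Submission
  imports Defs
begin

text \<open>
  Why the mechanism loses only order \<open>sqrt \<theta>\<close>. After the first period the loads of a period are fresh
  independent Poisson numbers, so the vector \<open>S\<close> of available carriers is a Markov chain of its own,
  and the expected profit of a period is an affine function of the mean numbers of bookings given
  \<open>S\<close>. Two things have to be shown: the long-run average exists, and the mean number of bookings on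
  lane \<open>e\<close> is in the long run within order \<open>sqrt \<theta>\<close> of its fluid value \<open>\<theta> * y e\<close>.

  Existence. With positive probability no load at all appears. Then nobody is booked, and the next
  supply consists of new arrivals only, whatever \<open>S\<close> was. Such a common regeneration makes the chain
  forget its start geometrically fast (\<open>doeblin_convergence\<close>).

  Bookings at one node. At the fluid prices the logit weight of lane \<open>(i, j)\<close> is \<open>y (i, j) / v i\<close>. So
  a carrier who still finds loads on all lanes books \<open>(i, j)\<close> with probability \<open>y (i, j) / T\<close> and leaves
  with probability \<open>v i / T\<close>, where \<open>T\<close> is the fluid supply of the node; when lanes are sold out, the
  probabilities of all other options only grow. Hence an option can fall behind its fluid share, or
  behind its number of loads, only by random fluctuation, and the squared deficit grows by at most
  one per carrier (\<open>deficit_step\<close>). Surpluses need no separate analysis: the counts of all options add up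
  to the number of carriers, so what one option has in excess others must lack. This yields
  order \<open>sqrt \<theta>\<close> for a node holding its fluid supply, and since one more carrier changes the bookings
  by at most one, the deviation at any other supply exceeds this by at most the distance of that
  supply from the fluid one (\<open>node_deviation\<close>).

  Contraction. A booked carrier stays with probability at most \<open>max_stay < 1\<close>. By flow balance the
  distance between supply and fluid supply, summed over nodes, therefore shrinks in mean by that
  factor in every period, up to noise of order \<open>sqrt \<theta>\<close> (\<open>supply_gap_contraction\<close>), so that it is of
  order \<open>sqrt \<theta>\<close> in the long run. This bounds the profit from both sides
  (\<open>long_run_profit_deviation\<close>).

  Fluid problem. The argument needs \<open>v i > 0\<close> at every node, which holds because a finite value rules
  out a node with outflow but no leaving carriers, and \<open>y e > 0\<close> wherever there is demand, which holds
  because the marginal profit of the first unit of flow is infinite. The fluid value is linear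
  in the scaling factor.
\<close>

section \<open>Upper bounds on means\<close>

text \<open>
  The mean of the positive part of \<open>f\<close> is at most \<open>c\<close>. Stated with the nonnegative integral, the
  bound carries integrability with it and passes through \<open>bind_pmf\<close> without side conditions.
\<close>

definition mean_le :: "'a pmf \<Rightarrow> ('a \<Rightarrow> real) \<Rightarrow> real \<Rightarrow> bool" where
  "mean_le p f c \<longleftrightarrow> 0 \<le> c \<and> (\<integral>\<^sup>+x. ennreal (f x) \<partial>measure_pmf p) \<le> ennreal c"

lemma mean_leD: "mean_le p f c \<Longrightarrow> 0 \<le> c"
  by (simp add: mean_le_def)

lemma mean_le_mono:
  assumes "mean_le p g c" "\<And>x. x \<in> set_pmf p \<Longrightarrow> f x \<le> g x" "c \<le> c'"
  shows "mean_le p f c'"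
proof -
  have "(\<integral>\<^sup>+x. ennreal (f x) \<partial>measure_pmf p) \<le> (\<integral>\<^sup>+x. ennreal (g x) \<partial>measure_pmf p)"
    using assms(2) by (intro nn_integral_mono_AE) (auto simp: AE_measure_pmf_iff ennreal_leI)
  with assms(1,3) show ?thesis
    unfolding mean_le_def by (meson ennreal_leI order_trans)
qed

lemma mean_le_const:
  assumes "\<And>x. x \<in> set_pmf p \<Longrightarrow> f x \<le> c" "0 \<le> c"
  shows "mean_le p f c"
proof (rule mean_le_mono[where g = "\<lambda>_. c"])
  show "mean_le p (\<lambda>_. c) c" using assms(2) by (simp add: mean_le_def)
qed (use assms in auto)

lemma mean_le_add:
  assumes "mean_le p f a" "mean_le p g b"
  shows "mean_le p (\<lambda>x. f x + g x) (a + b)"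
proof -
  have le: "ennreal (u + w) \<le> ennreal u + ennreal w" for u w :: real
  proof -
    have "ennreal (u + w) \<le> ennreal (max 0 u + max 0 w)" by (intro ennreal_leI) auto
    also have "\<dots> = ennreal u + ennreal w"
      by (subst ennreal_plus) (auto simp: max_def ennreal_neg)
    finally show ?thesis .
  qed
  have "(\<integral>\<^sup>+x. ennreal (f x + g x) \<partial>measure_pmf p)
      \<le> (\<integral>\<^sup>+x. ennreal (f x) + ennreal (g x) \<partial>measure_pmf p)"
    by (intro nn_integral_mono le)
  also have "\<dots> = (\<integral>\<^sup>+x. ennreal (f x) \<partial>measure_pmf p) + (\<integral>\<^sup>+x. ennreal (g x) \<partial>measure_pmf p)"
    by (rule nn_integral_add) auto
  also have "\<dots> \<le> ennreal a + ennreal b"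
    using assms by (intro add_mono) (auto simp: mean_le_def)
  finally show ?thesis
    using assms by (simp add: mean_le_def ennreal_plus)
qed

lemma mean_le_sum:
  assumes "\<And>i. i \<in> I \<Longrightarrow> mean_le p (f i) (c i)"
  shows "mean_le p (\<lambda>x. \<Sum>i\<in>I. f i x) (\<Sum>i\<in>I. c i)"
proof (cases "finite I")
  case True
  then show ?thesis using assms
  proof (induction I)
    case (insert i I)
    then show ?case by (auto intro: mean_le_add)
  qed (simp add: mean_le_const)
qed (simp add: mean_le_const)

lemma mean_le_cmult:
  assumes "mean_le p f c" "0 \<le> a"
  shows "mean_le p (\<lambda>x. a * f x) (a * c)"
  using assms
  by (auto simp: mean_le_def ennreal_mult' ennreal_mult'' nn_integral_cmult intro!: mult_left_mono)

lemma mean_le_bind: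
  assumes "\<And>x. x \<in> set_pmf p \<Longrightarrow> mean_le (k x) f (g x)" "mean_le p g c"
  shows "mean_le (bind_pmf p k) f c"
proof -
  have "(\<integral>\<^sup>+x. ennreal (f x) \<partial>measure_pmf (bind_pmf p k)) \<le> (\<integral>\<^sup>+x. ennreal (g x) \<partial>measure_pmf p)"
    using assms(1)
    by (auto simp: AE_measure_pmf_iff mean_le_def intro!: nn_integral_mono_AE)
  with assms(2) show ?thesis by (auto simp: mean_le_def intro: order_trans)
qed

text \<open>
  A lower bound along every transition turns a bound on the later mean into one on the earlier.
\<close>

lemma mean_le_bind_reverse:
  assumes "mean_le (bind_pmf p k) f c"
    and "\<And>x y. x \<in> set_pmf p \<Longrightarrow> y \<in> set_pmf (k x) \<Longrightarrow> g x \<le> f y"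
  shows "mean_le p g c"
proof -
  have "ennreal (g x) \<le> (\<integral>\<^sup>+y. ennreal (f y) \<partial>measure_pmf (k x))" if "x \<in> set_pmf p" for x
  proof -
    have "ennreal (g x) = (\<integral>\<^sup>+y. ennreal (g x) \<partial>measure_pmf (k x))" by simp
    also have "\<dots> \<le> (\<integral>\<^sup>+y. ennreal (f y) \<partial>measure_pmf (k x))"
      using assms(2)[OF that]
      by (intro nn_integral_mono_AE) (auto simp: AE_measure_pmf_iff ennreal_leI)
    finally show ?thesis .
  qed
  then have "(\<integral>\<^sup>+x. ennreal (g x) \<partial>measure_pmf p)
      \<le> (\<integral>\<^sup>+x. \<integral>\<^sup>+y. ennreal (f y) \<partial>measure_pmf (k x) \<partial>measure_pmf p)"
    by (intro nn_integral_mono_AE) (auto simp: AE_measure_pmf_iff)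
  with assms(1) show ?thesis by (auto simp: mean_le_def intro: order_trans)
qed

lemma mean_le_map [simp]: "mean_le (map_pmf h p) f c \<longleftrightarrow> mean_le p (\<lambda>x. f (h x)) c"
  by (simp add: mean_le_def)

lemma mean_le_return [simp]: "mean_le (return_pmf x) f c \<longleftrightarrow> 0 \<le> c \<and> f x \<le> c"
  by (auto simp: mean_le_def ennreal_le_iff2)

lemma mean_le_Pi_pmf:
  assumes "finite A" "x \<in> A" "mean_le (p x) f c"
  shows "mean_le (Pi_pmf A dflt p) (\<lambda>h. f (h x)) c"
proof -
  have "mean_le (map_pmf (\<lambda>h. h x) (Pi_pmf A dflt p)) f c"
    using assms by (simp add: Pi_pmf_component del: mean_le_map)
  then show ?thesis by simp
qed

lemma mean_leI:
  assumes "integrable (measure_pmf p) f" "measure_pmf.expectation p f \<le> c"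
    and "\<And>x. x \<in> set_pmf p \<Longrightarrow> 0 \<le> f x"
  shows "mean_le p f c"
proof -
  have ae: "AE x in measure_pmf p. 0 \<le> f x" using assms(3) by (simp add: AE_measure_pmf_iff)
  have "0 \<le> measure_pmf.expectation p f" using ae by (rule integral_nonneg_AE)
  with assms(1,2) ae show ?thesis
    by (simp add: mean_le_def nn_integral_eq_integral ennreal_leI)
qed

lemma mean_le_expectation:
  assumes "mean_le p f c" "\<And>x. x \<in> set_pmf p \<Longrightarrow> 0 \<le> f x"
  shows "integrable (measure_pmf p) f" "measure_pmf.expectation p f \<le> c"
proof -
  have ae: "AE x in measure_pmf p. 0 \<le> f x" using assms(2) by (simp add: AE_measure_pmf_iff)
  show int: "integrable (measure_pmf p) f"
    using assms(1) ae
    by (intro integrableI_nonneg) (auto simp: mean_le_def intro: le_less_trans)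
  have "ennreal (measure_pmf.expectation p f) \<le> ennreal c"
    using assms(1) nn_integral_eq_integral[OF int ae] by (simp add: mean_le_def)
  then show "measure_pmf.expectation p f \<le> c"
    using mean_leD[OF assms(1)] by (simp add: ennreal_le_iff)
qed

text \<open>
  All \<open>sqrt \<theta>\<close> rates come from here, with \<open>c = \<theta>\<close>: the inequality \<open>\<bar>x\<bar> \<le> x\<^sup>2 / (2 * sqrt c) + sqrt c / 2\<close> is
  used in place of the one between first and second moments, since it is linear in the second
  moment and so survives averaging over a random bound.
\<close>

lemma mean_le_abs_of_square:
  assumes "mean_le p (\<lambda>x. (f x)\<^sup>2) (c * V)" "0 < c"
  shows "mean_le p (\<lambda>x. \<bar>f x\<bar>) (sqrt c * (V + 1) / 2)"
proof (rule mean_le_mono)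
  have "mean_le p (\<lambda>x. 1 / (2 * sqrt c) * (f x)\<^sup>2 + sqrt c / 2) (1 / (2 * sqrt c) * (c * V) + sqrt c / 2)"
    by (intro mean_le_add mean_le_cmult assms(1)) (use assms(2) in \<open>auto intro: mean_le_const\<close>)
  also have "1 / (2 * sqrt c) * (c * V) + sqrt c / 2 = sqrt c * (V + 1) / 2"
  proof -
    have "c = sqrt c * sqrt c" using assms(2) by simp
    then have "1 / (2 * sqrt c) * (c * V) = sqrt c * V / 2"
      using assms(2) by (simp add: divide_simps)
    then show ?thesis by (simp add: algebra_simps add_divide_distrib)
  qed
  finally show "mean_le p (\<lambda>x. 1 / (2 * sqrt c) * (f x)\<^sup>2 + sqrt c / 2) (sqrt c * (V + 1) / 2)" .
  show "\<bar>f x\<bar> \<le> 1 / (2 * sqrt c) * (f x)\<^sup>2 + sqrt c / 2" for x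
  proof -
    have "0 \<le> (\<bar>f x\<bar> - sqrt c)\<^sup>2" by simp
    then have "2 * sqrt c * \<bar>f x\<bar> \<le> (f x)\<^sup>2 + (sqrt c)\<^sup>2" by (simp add: power2_diff mult.commute mult.left_commute)
    then show ?thesis using assms(2) by (simp add: field_simps power2_eq_square)
  qed
qed simp

lemma mean_le_event:
  fixes u w :: real
  assumes "0 \<le> u" "0 \<le> w"
  shows "mean_le p (\<lambda>c. if c = c0 then u else w) (pmf p c0 * u + (1 - pmf p c0) * w)"
proof (rule mean_leI)
  have eq: "(\<lambda>c. if c = c0 then u else w) = (\<lambda>c. (u - w) * indicator {c0} c + w)"
    by (auto simp: indicator_def)
  have int: "integrable (measure_pmf p) (indicator {c0} :: _ \<Rightarrow> real)"
    by (rule measure_pmf.integrable_const_bound[where B = 1]) auto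
  show "integrable (measure_pmf p) (\<lambda>c. if c = c0 then u else w)"
    unfolding eq by (intro Bochner_Integration.integrable_add integrable_mult_right int) auto
  have "measure_pmf.expectation p (\<lambda>c. (u - w) * indicator {c0} c + w) = (u - w) * pmf p c0 + w"
    by (subst Bochner_Integration.integral_add)
       (use int in \<open>auto simp: measure_pmf_single intro!: integrable_mult_right\<close>)
  then show "measure_pmf.expectation p (\<lambda>c. if c = c0 then u else w)
      \<le> pmf p c0 * u + (1 - pmf p c0) * w"
    unfolding eq by (simp add: algebra_simps)
qed (use assms in auto)

section \<open>Second moments of binomial and Poisson variables\<close>

lemma binomial_second_moment:
  assumes "0 \<le> q" "q \<le> 1"
  shows "mean_le (binomial_pmf n q) (\<lambda>z. (real z - q * real n)\<^sup>2) (real n)"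
proof (induction n)
  case 0
  then show ?case using assms by (simp add: binomial_pmf_0)
next
  case (Suc n)
  have q: "q \<in> {0..1}" using assms by simp
  have eq: "binomial_pmf (Suc n) q = bind_pmf (binomial_pmf n q)
      (\<lambda>z. map_pmf (\<lambda>b. (if b then 1 else 0) + z) (bernoulli_pmf q))"
    unfolding binomial_pmf_Suc[OF q] by (subst bind_commute_pmf) (simp add: map_pmf_def)
  have "mean_le (bernoulli_pmf q) (\<lambda>b. (real ((if b then 1 else 0) + z) - q * real (Suc n))\<^sup>2)
      ((real z - q * real n)\<^sup>2 + 1)" for z
  proof -
    let ?a = "real z - q * real n"
    have "mean_le (bernoulli_pmf q) (\<lambda>b. if b = True then (?a + 1 - q)\<^sup>2 else (?a - q)\<^sup>2)
      (pmf (bernoulli_pmf q) True * (?a + 1 - q)\<^sup>2 + (1 - pmf (bernoulli_pmf q) True) * (?a - q)\<^sup>2)"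
      by (rule mean_le_event) auto
    also have "pmf (bernoulli_pmf q) True * (?a + 1 - q)\<^sup>2 + (1 - pmf (bernoulli_pmf q) True) * (?a - q)\<^sup>2
       = ?a\<^sup>2 + q * (1 - q)"
      using assms by (simp add: power2_eq_square algebra_simps)
    finally show ?thesis
    proof (rule mean_le_mono)
      have "q * (1 - q) \<le> 1 * 1" using assms by (intro mult_mono) auto
      then show "?a\<^sup>2 + q * (1 - q) \<le> ?a\<^sup>2 + 1" by simp
    qed (auto simp: algebra_simps)
  qed
  moreover have "mean_le (binomial_pmf n q) (\<lambda>z. (real z - q * real n)\<^sup>2 + 1) (real (Suc n))"
    using mean_le_add[OF Suc mean_le_const[of _ "\<lambda>_. 1" 1]] by (simp add: add.commute)
  ultimately show ?case
    unfolding eq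
    by (intro mean_le_bind[where g = "\<lambda>z. (real z - q * real n)\<^sup>2 + 1"]) (simp_all only: mean_le_map)
qed

lemma poisson_sums:
  fixes \<mu> :: real
  shows "(\<lambda>k. \<mu> ^ k / fact k * exp (-\<mu>)) sums 1"
    and "(\<lambda>k. real k * (\<mu> ^ k / fact k * exp (-\<mu>))) sums \<mu>"
    and "(\<lambda>k. real k * (real k - 1) * (\<mu> ^ k / fact k * exp (-\<mu>))) sums \<mu>\<^sup>2"
proof -
  have "(\<lambda>k. \<mu> ^ k / fact k) sums exp \<mu>"
    using exp_converges[of \<mu>] by (simp add: field_simps)
  from sums_mult2[OF this, of "exp (-\<mu>)"]
  show 0: "(\<lambda>k. \<mu> ^ k / fact k * exp (-\<mu>)) sums 1" by (simp add: exp_minus)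
  have "(\<lambda>k. real (Suc k) * (\<mu> ^ Suc k / fact (Suc k) * exp (-\<mu>))) sums (\<mu> * 1)"
    using sums_mult[OF 0, of \<mu>] by (simp add: divide_simps mult.assoc)
  from sums_Suc[OF this]
  show 1: "(\<lambda>k. real k * (\<mu> ^ k / fact k * exp (-\<mu>))) sums \<mu>" by simp
  have "(\<lambda>k. real (Suc k) * (real (Suc k) - 1) * (\<mu> ^ Suc k / fact (Suc k) * exp (-\<mu>))) sums (\<mu> * \<mu>)"
    using sums_mult[OF 1, of \<mu>] by (simp add: divide_simps mult_ac)
  from sums_Suc[OF this]
  show "(\<lambda>k. real k * (real k - 1) * (\<mu> ^ k / fact k * exp (-\<mu>))) sums \<mu>\<^sup>2"
    by (simp add: power2_eq_square)
qed

lemma poisson_nn_integral: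
  assumes "0 < \<mu>" "(\<lambda>k. f k * (\<mu> ^ k / fact k * exp (-\<mu>))) sums c" "\<And>k. 0 \<le> f k"
  shows "(\<integral>\<^sup>+k. ennreal (f k) \<partial>measure_pmf (poisson_pmf \<mu>)) = ennreal c"
proof -
  have "(\<integral>\<^sup>+k. ennreal (f k) \<partial>measure_pmf (poisson_pmf \<mu>))
      = (\<Sum>k. ennreal (f k * (\<mu> ^ k / fact k * exp (-\<mu>))))"
    using assms(1,3)
    by (simp add: nn_integral_measure_pmf nn_integral_count_space_nat ennreal_mult[symmetric] mult.commute)
  also have "\<dots> = ennreal c"
    using assms by (intro suminf_ennreal_eq) auto
  finally show ?thesis .
qed

lemma poisson_mean:
  assumes "0 \<le> \<mu>"
  shows "(\<integral>\<^sup>+k. ennreal (real k) \<partial>measure_pmf (poisson_dist \<mu>)) = ennreal \<mu>"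
proof (cases "\<mu> = 0")
  case False
  with assms show ?thesis
    using poisson_nn_integral[OF _ poisson_sums(2)] by (simp add: poisson_dist_def)
qed (simp add: poisson_dist_def)

lemma poisson_second_moment:
  assumes "0 \<le> \<mu>"
  shows "mean_le (poisson_dist \<mu>) (\<lambda>k. (real k - \<mu>)\<^sup>2) \<mu>"
proof (cases "\<mu> = 0")
  case False
  then have "0 < \<mu>" using assms by simp
  let ?w = "\<lambda>k. \<mu> ^ k / fact k * exp (-\<mu>)"
  have "(\<lambda>k. real k * (real k - 1) * ?w k + (1 - 2 * \<mu>) * (real k * ?w k) + \<mu>\<^sup>2 * ?w k)
      sums (\<mu>\<^sup>2 + (1 - 2 * \<mu>) * \<mu> + \<mu>\<^sup>2 * 1)"
    by (intro sums_add sums_mult poisson_sums)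
  also have "(\<lambda>k. real k * (real k - 1) * ?w k + (1 - 2 * \<mu>) * (real k * ?w k) + \<mu>\<^sup>2 * ?w k)
      = (\<lambda>k. (real k - \<mu>)\<^sup>2 * ?w k)"
  proof
    show "real k * (real k - 1) * ?w k + (1 - 2 * \<mu>) * (real k * ?w k) + \<mu>\<^sup>2 * ?w k
        = (real k - \<mu>)\<^sup>2 * ?w k" for k
      by (rule trans[OF _ arg_cong[where f = "\<lambda>x. x * ?w k"]], simp only: distrib_right[symmetric] mult.assoc[symmetric])
         (simp add: power2_eq_square algebra_simps)
  qed
  also have "\<mu>\<^sup>2 + (1 - 2 * \<mu>) * \<mu> + \<mu>\<^sup>2 * 1 = \<mu>"
    by (simp add: power2_eq_square algebra_simps)
  finally show ?thesis
    using poisson_nn_integral[OF \<open>0 < \<mu>\<close>, of "\<lambda>k. (real k - \<mu>)\<^sup>2" \<mu>] False assms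
    by (simp add: mean_le_def poisson_dist_def)
qed (simp add: poisson_dist_def)

section \<open>Convergence of regenerating Markov chains\<close>

text \<open>
  Nonnegativity reduces this to the tower rule for nonnegative integrals, so that \<open>f\<close> may be unbounded.
\<close>

lemma expectation_bind:
  fixes f :: "'a \<Rightarrow> real"
  assumes "integrable (measure_pmf (bind_pmf p k)) f" "\<And>x. 0 \<le> f x"
  shows "measure_pmf.expectation (bind_pmf p k) f
    = measure_pmf.expectation p (\<lambda>x. measure_pmf.expectation (k x) f)"
proof -
  have fin: "(\<integral>\<^sup>+x. \<integral>\<^sup>+y. ennreal (f y) \<partial>measure_pmf (k x) \<partial>measure_pmf p) \<noteq> \<infinity>"
    using assms by (simp add: integrable_iff_bounded)
  have "AE x in measure_pmf p. (\<integral>\<^sup>+y. ennreal (f y) \<partial>measure_pmf (k x)) \<noteq> \<infinity>"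
    by (rule nn_integral_PInf_AE[OF _ fin]) simp
  then have int: "integrable (measure_pmf (k x)) f" if "x \<in> set_pmf p" for x
    using that assms(2) by (auto simp: AE_measure_pmf_iff integrable_iff_bounded less_top)
  have "measure_pmf.expectation (bind_pmf p k) f
      = enn2real (\<integral>\<^sup>+x. \<integral>\<^sup>+y. ennreal (f y) \<partial>measure_pmf (k x) \<partial>measure_pmf p)"
    using assms(2) by (simp add: integral_eq_nn_integral)
  also have "(\<integral>\<^sup>+x. \<integral>\<^sup>+y. ennreal (f y) \<partial>measure_pmf (k x) \<partial>measure_pmf p)
      = (\<integral>\<^sup>+x. ennreal (measure_pmf.expectation (k x) f) \<partial>measure_pmf p)"
    using int assms(2)
    by (intro nn_integral_cong_AE) (auto simp: AE_measure_pmf_iff nn_integral_eq_integral)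
  also have "enn2real \<dots> = measure_pmf.expectation p (\<lambda>x. measure_pmf.expectation (k x) f)"
    using assms(2) by (simp add: integral_eq_nn_integral)
  finally show ?thesis .
qed

lemma integrable_bounded_pmf:
  fixes f :: "'a \<Rightarrow> real"
  assumes "\<And>x. \<bar>f x\<bar> \<le> B"
  shows "integrable (measure_pmf p) f"
  using assms by (intro measure_pmf.integrable_const_bound[where B = B]) auto

lemma expectation_bounded:
  fixes f :: "'a \<Rightarrow> real"
  assumes "\<And>x. \<bar>f x\<bar> \<le> B"
  shows "\<bar>measure_pmf.expectation p f\<bar> \<le> B"
proof -
  have "- B \<le> f x \<and> f x \<le> B" for x using assms[of x] by linarith
  then show ?thesis
    using measure_pmf.integral_le_const[OF integrable_bounded_pmf[of f B p, OF assms], of B]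
      measure_pmf.integral_ge_const[OF integrable_bounded_pmf[of f B p, OF assms], of "- B"]
    by (simp add: abs_le_iff minus_le_iff)
qed

lemma expectation_bind_bounded:
  fixes f :: "'a \<Rightarrow> real"
  assumes "\<And>x. \<bar>f x\<bar> \<le> B"
  shows "measure_pmf.expectation (bind_pmf p k) f
    = measure_pmf.expectation p (\<lambda>x. measure_pmf.expectation (k x) f)"
proof -
  note int = integrable_bounded_pmf[of f, OF assms]
  have shift: "measure_pmf.expectation q (\<lambda>x. f x + B) = measure_pmf.expectation q f + B" for q
    using int[of q] by simp
  have int': "integrable (measure_pmf p) (\<lambda>x. measure_pmf.expectation (k x) f)"
    by (rule integrable_bounded_pmf[where B = B], rule expectation_bounded, rule assms)
  have "0 \<le> f x + B" for x using assms[of x] by linarith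
  then have "measure_pmf.expectation (bind_pmf p k) (\<lambda>x. f x + B)
      = measure_pmf.expectation p (\<lambda>x. measure_pmf.expectation (k x) (\<lambda>x. f x + B))"
    using int by (intro expectation_bind) auto
  then show ?thesis using int' by (simp add: shift)
qed

lemma expectation_diff_le_oscillation:
  fixes f :: "'a \<Rightarrow> real"
  assumes "\<And>x. \<bar>f x\<bar> \<le> B" "\<And>x y. f x - f y \<le> \<delta>"
  shows "measure_pmf.expectation p f - measure_pmf.expectation q f \<le> \<delta>"
proof -
  note int = integrable_bounded_pmf[of f, OF assms(1)]
  have "measure_pmf.expectation p f \<le> f y + \<delta>" for y
    using assms(2)[of _ y] int[of p] by (intro measure_pmf.integral_le_const) (auto simp: algebra_simps)
  then have "measure_pmf.expectation p f - \<delta> \<le> f y" for y by (simp add: algebra_simps)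
  then have "measure_pmf.expectation p f - \<delta> \<le> measure_pmf.expectation q f"
    using int[of q] by (intro measure_pmf.integral_ge_const) auto
  then show ?thesis by linarith
qed

text \<open>
  Two mixtures over the same \<open>\<mu>\<close> that agree in the component \<open>b0\<close> can differ only on the remaining
  mass \<open>1 - pmf \<mu> b0\<close>.
\<close>

lemma common_component_contraction:
  fixes f :: "'a \<Rightarrow> real" and \<mu> :: "'b pmf"
  assumes bound: "\<And>x. \<bar>f x\<bar> \<le> B" and osc: "\<And>x y. f x - f y \<le> \<delta>" and common: "k b0 = k' b0"
  shows "measure_pmf.expectation (bind_pmf \<mu> k) f - measure_pmf.expectation (bind_pmf \<mu> k') f
    \<le> (1 - pmf \<mu> b0) * \<delta>"
proof -
  let ?D = "\<lambda>b. measure_pmf.expectation (k b) f - measure_pmf.expectation (k' b) f"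
  have int: "integrable (measure_pmf \<mu>) (\<lambda>b. measure_pmf.expectation (h b) f)" for h
    by (rule integrable_bounded_pmf[where B = B], rule expectation_bounded, rule bound)
  have ind: "integrable (measure_pmf \<mu>) (indicator {b0} :: _ \<Rightarrow> real)"
    by (rule measure_pmf.integrable_const_bound[where B = 1]) auto
  have "measure_pmf.expectation (bind_pmf \<mu> k) f - measure_pmf.expectation (bind_pmf \<mu> k') f
      = measure_pmf.expectation \<mu> ?D"
    using int by (simp add: expectation_bind_bounded[of f, OF bound])
  also have "\<dots> \<le> measure_pmf.expectation \<mu> (\<lambda>b. \<delta> - \<delta> * indicator {b0} b)"
  proof (rule integral_mono)
    show "?D b \<le> \<delta> - \<delta> * indicator {b0} b" for b
      using common expectation_diff_le_oscillation[of f, OF bound osc] by (auto simp: indicator_def)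
  qed (use int ind in auto)
  also have "\<dots> = (1 - pmf \<mu> b0) * \<delta>"
    using ind by (simp add: measure_pmf_single algebra_simps)
  finally show ?thesis .
qed

text \<open>
  The iterates \<open>F t s\<close>, the expected reward after \<open>t\<close> steps from \<open>s\<close>, have an oscillation that shrinks by
  the factor \<open>1 - pmf \<mu> b0\<close> in every step. As \<open>F (Suc t) s\<close> is an average of values of \<open>F t\<close>, the expected
  rewards form a Cauchy sequence, and the vanishing oscillation makes their limit independent of
  the start.
\<close>

lemma doeblin_convergence:
  fixes \<mu> :: "'b pmf" and k :: "'a \<Rightarrow> 'b \<Rightarrow> 'a pmf" and f :: "'a \<Rightarrow> real"
  assumes pos: "0 < pmf \<mu> b0" and regen: "\<And>s s'. k s b0 = k s' b0" and bound: "\<And>s. \<bar>f s\<bar> \<le> B"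
  shows "\<exists>g. \<forall>\<sigma>. (\<lambda>t. measure_pmf.expectation
    (((\<lambda>\<rho>. bind_pmf \<rho> (\<lambda>s. bind_pmf \<mu> (k s))) ^^ t) \<sigma>) f) \<longlonglongrightarrow> g"
proof -
  define K where "K s = bind_pmf \<mu> (k s)" for s
  define F where "F t = ((\<lambda>h s. measure_pmf.expectation (K s) h) ^^ t) f" for t
  define a where "a \<sigma> t = measure_pmf.expectation (((\<lambda>\<rho>. bind_pmf \<rho> K) ^^ t) \<sigma>) f" for \<sigma> t
  define \<eta> where "\<eta> = 1 - pmf \<mu> b0"
  have \<eta>: "0 \<le> \<eta>" "\<eta> < 1" using pos pmf_le_1[of \<mu> b0] by (auto simp: \<eta>_def)
  have F_Suc: "F (Suc t) s = measure_pmf.expectation (K s) (F t)" for t s by (simp add: F_def)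
  have F_bound: "\<bar>F t s\<bar> \<le> B" for t s
  proof (induction t arbitrary: s)
    case (Suc t)
    then show ?case unfolding F_Suc by (intro expectation_bounded)
  qed (simp add: F_def bound)
  note F_int = integrable_bounded_pmf[of "F _", OF F_bound]
  have a_eq: "a \<sigma> t = measure_pmf.expectation \<sigma> (F t)" for \<sigma> t
  proof -
    have "measure_pmf.expectation (((\<lambda>\<rho>. bind_pmf \<rho> K) ^^ n) \<sigma>) (F m)
        = measure_pmf.expectation \<sigma> (F (m + n))" for n m
    proof (induction n arbitrary: m)
      case (Suc n)
      have "measure_pmf.expectation (((\<lambda>\<rho>. bind_pmf \<rho> K) ^^ Suc n) \<sigma>) (F m)
          = measure_pmf.expectation (((\<lambda>\<rho>. bind_pmf \<rho> K) ^^ n) \<sigma>) (F (Suc m))"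
        by (simp add: expectation_bind_bounded[of "F m", OF F_bound] F_Suc[abs_def])
      then show ?case using Suc[of "Suc m"] by simp
    qed simp
    from this[of t 0] show ?thesis by (simp add: a_def F_def)
  qed
  have osc: "F t x - F t y \<le> 2 * B * \<eta> ^ t" for t x y
  proof (induction t arbitrary: x y)
    case 0
    show ?case using bound[of x] bound[of y] by (simp add: F_def)
  next
    case (Suc t)
    have "F (Suc t) x - F (Suc t) y \<le> \<eta> * (2 * B * \<eta> ^ t)"
      unfolding F_Suc K_def \<eta>_def
      by (rule common_component_contraction[where f = "F t", OF F_bound])
         (use Suc[unfolded \<eta>_def] regen in auto)
    then show ?case by (simp add: algebra_simps)
  qed
  have step: "\<bar>a \<sigma> (Suc t) - a \<sigma> t\<bar> \<le> 2 * B * \<eta> ^ t" for \<sigma> t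
  proof -
    have *: "a \<sigma> (Suc t) = measure_pmf.expectation (bind_pmf \<sigma> K) (F t)"
      unfolding a_eq F_Suc[abs_def] by (simp add: expectation_bind_bounded[of "F t", OF F_bound])
    show ?thesis
      unfolding * a_eq[of \<sigma> t]
      using expectation_diff_le_oscillation[where f = "F t" and p = "bind_pmf \<sigma> K" and q = \<sigma>, OF F_bound osc]
        expectation_diff_le_oscillation[where f = "F t" and p = \<sigma> and q = "bind_pmf \<sigma> K", OF F_bound osc]
      by linarith
  qed
  have conv: "convergent (a \<sigma>)" for \<sigma>
  proof -
    have "summable (\<lambda>t. a \<sigma> (Suc t) - a \<sigma> t)"
    proof (rule summable_comparison_test)
      show "summable (\<lambda>t. 2 * B * \<eta> ^ t)" using \<eta> by (intro summable_mult summable_geometric) auto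
    qed (use step in auto)
    then have "(\<lambda>n. (\<Sum>t<n. a \<sigma> (Suc t) - a \<sigma> t) + a \<sigma> 0)
        \<longlonglongrightarrow> (\<Sum>t. a \<sigma> (Suc t) - a \<sigma> t) + a \<sigma> 0"
      by (intro tendsto_add summable_LIMSEQ) auto
    then show ?thesis by (auto simp: sum_lessThan_telescope convergent_def)
  qed
  have same: "lim (a \<sigma>) = lim (a \<tau>)" for \<sigma> \<tau>
  proof -
    have "(\<lambda>t. 2 * B * \<eta> ^ t) \<longlonglongrightarrow> 2 * B * 0"
      using \<eta> by (intro tendsto_mult_left LIMSEQ_power_zero) auto
    moreover have "\<bar>a \<sigma> t - a \<tau> t\<bar> \<le> 2 * B * \<eta> ^ t" for t
      unfolding a_eq using expectation_diff_le_oscillation[where f = "F t", OF F_bound osc] by (simp add: abs_le_iff)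
    ultimately have "(\<lambda>t. a \<sigma> t - a \<tau> t) \<longlonglongrightarrow> 0"
      by (intro Lim_null_comparison[where f = "\<lambda>t. a \<sigma> t - a \<tau> t" and g = "\<lambda>t. 2 * B * \<eta> ^ t"]) auto
    moreover have "(\<lambda>t. a \<sigma> t - a \<tau> t) \<longlonglongrightarrow> lim (a \<sigma>) - lim (a \<tau>)"
      using conv by (intro tendsto_diff) (simp_all add: convergent_LIMSEQ_iff)
    ultimately have "lim (a \<sigma>) - lim (a \<tau>) = 0" using LIMSEQ_unique by blast
    then show ?thesis by simp
  qed
  have "a \<sigma> \<longlonglongrightarrow> lim (a undefined)" for \<sigma>
    using conv[of \<sigma>] same[of \<sigma> undefined] by (simp add: convergent_LIMSEQ_iff)
  then show ?thesis unfolding a_def K_def by blast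
qed

lemma cesaro_mean_tendsto:
  fixes f :: "nat \<Rightarrow> real"
  assumes "f \<longlonglongrightarrow> g"
  shows "(\<lambda>n. (\<Sum>k<n. f k) / real n) \<longlonglongrightarrow> g"
proof -
  have "(\<lambda>n. (\<Sum>k<n. f k - g) / real n) \<longlonglongrightarrow> 0"
  proof (rule LIMSEQ_I)
    fix e :: real assume "0 < e"
    then obtain N where N: "\<And>k. N \<le> k \<Longrightarrow> \<bar>f k - g\<bar> < e / 2"
      using LIMSEQ_D[OF assms, of "e / 2"] by auto
    define C where "C = (\<Sum>k<N. \<bar>f k - g\<bar>)"
    obtain N' where N': "2 * C / e < real N'" using reals_Archimedean2 by blast
    have "\<bar>(\<Sum>k<n. f k - g) / real n\<bar> < e" if n: "max (Suc N) N' \<le> n" for n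
    proof -
      have "\<bar>\<Sum>k<n. f k - g\<bar> \<le> (\<Sum>k<n. \<bar>f k - g\<bar>)" by (rule sum_abs)
      also have "\<dots> \<le> (\<Sum>k<n. (if k < N then \<bar>f k - g\<bar> else 0) + e / 2)"
        using N \<open>0 < e\<close> by (intro sum_mono) (auto simp: not_less less_imp_le)
      also have "\<dots> = C + real n * (e / 2)"
        using n by (simp add: sum.distrib C_def sum.If_cases Int_def) (auto intro!: sum.cong)
      also have "\<dots> < real n * e"
      proof -
        have "2 * C / e < real n" using N' n by linarith
        then show ?thesis using \<open>0 < e\<close> by (simp add: field_simps)
      qed
      finally show ?thesis using n by (simp add: field_simps)
    qed
    then show "\<exists>no. \<forall>n\<ge>no. norm ((\<Sum>k<n. f k - g) / real n - 0) < e"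
      by (intro exI[of _ "max (Suc N) N'"]) simp
  qed
  then have "(\<lambda>n. (\<Sum>k<n. f k - g) / real n + g) \<longlonglongrightarrow> 0 + g" by (intro tendsto_intros)
  moreover have "eventually (\<lambda>n. (\<Sum>k<n. f k - g) / real n + g = (\<Sum>k<n. f k) / real n) sequentially"
    using eventually_gt_at_top[of 0] by eventually_elim (simp add: sum_subtractf field_simps)
  ultimately show ?thesis by (simp add: tendsto_cong)
qed

section \<open>Bookings at a single node\<close>

definition choice_weight :: "'n market \<Rightarrow> ('n \<times> 'n \<Rightarrow> real) \<Rightarrow> 'n \<Rightarrow> 'n \<Rightarrow> real" where
  "choice_weight M p i j = exp (sensitivity M * p (i, j) - disutility M (i, j))"

lemma pmf_choice:
  fixes M :: "'n::finite market" and p :: "'n \<times> 'n \<Rightarrow> real" and i :: 'n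
  defines "w \<equiv> choice_weight M p i"
  shows "pmf (choice_pmf M p i A) c = (case c of None \<Rightarrow> 1 / (1 + sum w A)
    | Some j \<Rightarrow> if j \<in> A then w j / (1 + sum w A) else 0)"
proof -
  let ?f = "\<lambda>c. case c of None \<Rightarrow> 1 / (1 + sum w A)
    | Some j \<Rightarrow> if j \<in> A then w j / (1 + sum w A) else 0"
  have W: "0 < 1 + sum w A"
    by (intro add_pos_nonneg sum_nonneg) (auto simp: w_def choice_weight_def)
  have nonneg: "0 \<le> ?f c" for c
    using W by (auto simp: w_def choice_weight_def split: option.split)
  have "(\<Sum>c\<in>UNIV. ?f c) = 1 / (1 + sum w A) + (\<Sum>j\<in>UNIV. if j \<in> A then w j / (1 + sum w A) else 0)"
    unfolding UNIV_option_conv by (subst sum.insert) (auto simp: sum.reindex)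
  also have "\<dots> = 1"
    using W by (simp add: sum.If_cases sum_divide_distrib[symmetric] add_divide_distrib[symmetric])
  finally have "(\<integral>\<^sup>+c. ennreal (?f c) \<partial>count_space UNIV) = 1"
    using nonneg by (simp add: nn_integral_count_space_finite sum_ennreal)
  note pmf_embed_pmf[OF nonneg this]
  moreover have "w = (\<lambda>j. exp (sensitivity M * p (i, j) - disutility M (i, j)))"
    by (simp add: fun_eq_iff w_def choice_weight_def)
  then have "choice_pmf M p i A = embed_pmf ?f" by (simp only: choice_pmf_def Let_def)
  ultimately show ?thesis by simp
qed

lemma node_bookings_support:
  fixes M :: "'n::finite market"
  assumes "Y \<in> set_pmf (node_bookings M p D i s)"
  shows "Y j \<le> D (i, j)" and "j \<notin> out_nbrs M i \<Longrightarrow> Y j = 0"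
    and "(\<Sum>j\<in>out_nbrs M i. Y j) \<le> s"
proof -
  have "(\<forall>j. Y j \<le> D (i, j)) \<and> (\<forall>j. j \<notin> out_nbrs M i \<longrightarrow> Y j = 0) \<and> (\<Sum>j\<in>out_nbrs M i. Y j) \<le> s"
    using assms
  proof (induction s arbitrary: Y)
    case (Suc s)
    then obtain X c where X: "X \<in> set_pmf (node_bookings M p D i s)"
      and c: "c \<in> set_pmf (choice_pmf M p i {j \<in> out_nbrs M i. X j < D (i, j)})"
      and Y: "Y = (case c of None \<Rightarrow> X | Some j \<Rightarrow> X(j := Suc (X j)))"
      by auto
    note IH = Suc.IH[OF X]
    show ?case
    proof (cases c)
      case (Some k)
      then have k: "k \<in> out_nbrs M i" "X k < D (i, k)"
        using c by (auto simp: set_pmf_iff pmf_choice split: if_splits)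
      have "(\<Sum>j\<in>out_nbrs M i. (X(k := Suc (X k))) j) = Suc (\<Sum>j\<in>out_nbrs M i. X j)"
        using k(1) by (simp add: sum.remove[of _ k])
      with Some k IH Y show ?thesis by auto
    qed (use IH Y in auto)
  qed simp
  then show "Y j \<le> D (i, j)" and "j \<notin> out_nbrs M i \<Longrightarrow> Y j = 0"
    and "(\<Sum>j\<in>out_nbrs M i. Y j) \<le> s" by auto
qed

text \<open>
  One step of a process whose target rises by \<open>\<pi>\<close> while its count rises by one with probability at
  least \<open>\<pi>\<close>. From a lag \<open>a \<ge> 0\<close> the drift is at most zero and the variance at most one; from
  \<open>a < 0\<close> the lag cannot exceed \<open>\<pi> \<le> 1\<close> after the step.
\<close>

lemma deficit_step:
  fixes a \<pi> :: real
  assumes "0 \<le> \<pi>" "\<pi> \<le> pmf q c0"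
  shows "mean_le q (\<lambda>c. (max 0 (a + \<pi> - (if c = c0 then 1 else 0)))\<^sup>2) ((max 0 a)\<^sup>2 + 1)"
proof -
  define \<pi>' where "\<pi>' = pmf q c0"
  define u w where "u = (max 0 (a + \<pi> - 1))\<^sup>2" and "w = (max 0 (a + \<pi>))\<^sup>2"
  have \<pi>': "\<pi> \<le> \<pi>'" "\<pi>' \<le> 1" using assms pmf_le_1[of q c0] by (auto simp: \<pi>'_def)
  have "u \<le> w" unfolding u_def w_def by (intro power_mono) auto
  then have "(\<pi>' - \<pi>) * (w - u) \<ge> 0" using \<pi>' by simp
  then have le: "\<pi>' * u + (1 - \<pi>') * w \<le> \<pi> * u + (1 - \<pi>) * w" by (simp add: algebra_simps)
  have "\<pi> * (1 - \<pi>) \<le> 1 * 1" using assms(1) \<pi>' by (intro mult_mono) auto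
  have "\<pi> * u + (1 - \<pi>) * w \<le> (max 0 a)\<^sup>2 + 1"
  proof (cases "0 \<le> a")
    case True
    have "u \<le> (a + \<pi> - 1)\<^sup>2" by (auto simp: u_def max_def)
    moreover have "w = (a + \<pi>)\<^sup>2" using True assms(1) by (simp add: w_def)
    ultimately have "\<pi> * u + (1 - \<pi>) * w \<le> \<pi> * (a + \<pi> - 1)\<^sup>2 + (1 - \<pi>) * (a + \<pi>)\<^sup>2"
      using assms(1) by (simp add: mult_left_mono)
    also have "\<dots> = a\<^sup>2 + \<pi> * (1 - \<pi>)" by (simp add: power2_eq_square algebra_simps)
    finally show ?thesis using True \<open>\<pi> * (1 - \<pi>) \<le> 1 * 1\<close> by simp
  next
    case False
    then have "u = 0" using \<pi>' by (simp add: u_def)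
    moreover have "w \<le> 1"
      using False \<pi>' by (auto simp: w_def max_def intro!: power_le_one)
    moreover have "0 \<le> w" by (simp add: w_def)
    ultimately have "\<pi> * u + (1 - \<pi>) * w \<le> 1"
      using assms(1) \<pi>' mult_mono[of "1 - \<pi>" 1 w 1] by simp
    then show ?thesis using False by simp
  qed
  with le have "\<pi>' * u + (1 - \<pi>') * w \<le> (max 0 a)\<^sup>2 + 1" by simp
  then have "mean_le q (\<lambda>c. if c = c0 then u else w) ((max 0 a)\<^sup>2 + 1)"
    unfolding \<pi>'_def
    by (intro mean_le_mono[OF mean_le_event]) (auto simp: u_def w_def)
  then show ?thesis
    by (rule mean_le_mono) (auto simp: u_def w_def)
qed

lemma node_process_square_bound:
  fixes G :: "nat \<Rightarrow> ('n::finite \<Rightarrow> nat) \<Rightarrow> real"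
  assumes "G 0 (\<lambda>_. 0) = 0"
    and "\<And>k Y. Y \<in> set_pmf (node_bookings M p D i k) \<Longrightarrow>
      mean_le (choice_pmf M p i {j \<in> out_nbrs M i. Y j < D (i, j)})
        (\<lambda>c. G (Suc k) (case c of None \<Rightarrow> Y | Some j \<Rightarrow> Y(j := Suc (Y j)))) (G k Y + 1)"
  shows "mean_le (node_bookings M p D i n) (G n) (real n)"
proof (induction n)
  case 0
  then show ?case using assms(1) by simp
next
  case (Suc n)
  have "mean_le (node_bookings M p D i n) (\<lambda>Y. G n Y + 1) (real n + 1)"
    by (intro mean_le_add Suc) (auto intro: mean_le_const)
  then show ?case
    using assms(2)
    by (auto simp: add.commute intro!: mean_le_bind[where g = "\<lambda>Y. G n Y + 1"])
qed

text \<open>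
  The target of lane \<open>(i, j)\<close> is its share \<open>\<pi> * n\<close>, capped at the number of loads. As long as loads
  remain, the lane is chosen with probability at least \<open>\<pi>\<close>; once they run out, the capped target is met.
\<close>

lemma lane_deficit:
  fixes M :: "'n::finite market"
  assumes "j \<in> out_nbrs M i" "0 \<le> \<pi>"
    and "\<And>A. j \<in> A \<Longrightarrow> A \<subseteq> {k \<in> out_nbrs M i. 0 < D (i, k)} \<Longrightarrow> \<pi> \<le> pmf (choice_pmf M p i A) (Some j)"
  shows "mean_le (node_bookings M p D i n)
    (\<lambda>Y. (max 0 (min (\<pi> * real n) (real (D (i, j))) - real (Y j)))\<^sup>2) (real n)"
proof (rule node_process_square_bound)
  fix k Y assume Y: "Y \<in> set_pmf (node_bookings M p D i k)"
  let ?A = "{j \<in> out_nbrs M i. Y j < D (i, j)}"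
  let ?G = "\<lambda>k Y. (max 0 (min (\<pi> * real k) (real (D (i, j))) - real (Y j)))\<^sup>2"
  let ?next = "\<lambda>c. case c of None \<Rightarrow> Y | Some j \<Rightarrow> Y(j := Suc (Y j))"
  show "mean_le (choice_pmf M p i ?A) (\<lambda>c. ?G (Suc k) (?next c)) (?G k Y + 1)"
  proof (cases "Y j < D (i, j)")
    case True
    let ?a = "min (\<pi> * real k) (real (D (i, j))) - real (Y j)"
    have \<pi>: "\<pi> \<le> pmf (choice_pmf M p i ?A) (Some j)"
      using True assms(1) by (intro assms(3)) auto
    show ?thesis
    proof (rule mean_le_mono[OF deficit_step[OF assms(2) \<pi>, of ?a]])
      fix c
      have "real (?next c j) = real (Y j) + (if c = Some j then 1 else 0)"
        by (auto split: option.split)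
      moreover have "min (\<pi> * real (Suc k)) (real (D (i, j))) \<le> min (\<pi> * real k) (real (D (i, j))) + \<pi>"
        using assms(2) by (auto simp: min_def algebra_simps)
      ultimately show "?G (Suc k) (?next c) \<le> (max 0 (?a + \<pi> - (if c = Some j then 1 else 0)))\<^sup>2"
        by (intro power_mono max.mono) auto
    qed simp
  next
    case False
    have "Y j \<le> ?next c j" for c by (auto split: option.split)
    then have "real (D (i, j)) \<le> real (?next c j)" for c
      using False by (metis le_trans not_less of_nat_le_iff)
    then have "min x (real (D (i, j))) - real (?next c j) \<le> 0" for c x
      by (smt (verit))
    then have "?G (Suc k) (?next c) = 0" for c
      by (simp only: max_absorb1) simp
    then show ?thesis by (intro mean_le_const) auto
  qed
qed simp

text \<open>
  The same bound for the outside option, whose count after \<open>n\<close> carriers is \<open>n\<close> minus all bookings.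
\<close>

lemma outside_deficit:
  fixes M :: "'n::finite market"
  assumes "0 \<le> \<pi>"
    and "\<And>A. A \<subseteq> {k \<in> out_nbrs M i. 0 < D (i, k)} \<Longrightarrow> \<pi> \<le> pmf (choice_pmf M p i A) None"
  shows "mean_le (node_bookings M p D i n)
    (\<lambda>Y. (max 0 (\<pi> * real n - (real n - (\<Sum>j\<in>out_nbrs M i. real (Y j)))))\<^sup>2) (real n)"
proof (rule node_process_square_bound)
  fix k Y assume Y: "Y \<in> set_pmf (node_bookings M p D i k)"
  let ?A = "{j \<in> out_nbrs M i. Y j < D (i, j)}"
  let ?S = "\<lambda>Y. \<Sum>j\<in>out_nbrs M i. real (Y j)"
  let ?G = "\<lambda>k Y. (max 0 (\<pi> * real k - (real k - ?S Y)))\<^sup>2"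
  let ?next = "\<lambda>c. case c of None \<Rightarrow> Y | Some j \<Rightarrow> Y(j := Suc (Y j))"
  let ?a = "\<pi> * real k - (real k - ?S Y)"
  have \<pi>: "\<pi> \<le> pmf (choice_pmf M p i ?A) None" by (intro assms(2)) auto
  show "mean_le (choice_pmf M p i ?A) (\<lambda>c. ?G (Suc k) (?next c)) (?G k Y + 1)"
  proof (rule mean_le_mono[OF deficit_step[OF assms(1) \<pi>, of ?a]])
    fix c assume c: "c \<in> set_pmf (choice_pmf M p i ?A)"
    have "?S (?next c) \<le> ?S Y + (if c = None then 0 else 1)"
    proof (cases c)
      case (Some l)
      then have "l \<in> out_nbrs M i" using c by (auto simp: set_pmf_iff pmf_choice split: if_splits)
      then have "?S (Y(l := Suc (Y l))) = ?S Y + 1" by (simp add: sum.remove[of _ l])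
      then show ?thesis using Some by simp
    qed simp
    then show "?G (Suc k) (?next c) \<le> (max 0 (?a + \<pi> - (if c = None then 1 else 0)))\<^sup>2"
      by (intro power_mono max.mono) (auto simp: algebra_simps)
  qed simp
qed simp

text \<open>
  Each further carrier changes at most one coordinate, and by one, so means for \<open>s\<close> and \<open>n\<close> carriers differ by
  at most \<open>\<bar>s - n\<bar>\<close>. The factor one in front of \<open>\<bar>s - n\<bar>\<close> is essential: only multiplied by the staying
  probability does it become a contraction.
\<close>

lemma node_bookings_lipschitz:
  fixes M :: "'n::finite market" and c :: "'n \<Rightarrow> real" and i :: 'n
  defines "\<phi> \<equiv> \<lambda>Y. \<Sum>j\<in>out_nbrs M i. \<bar>real (Y j) - c j\<bar>"
  assumes "mean_le (node_bookings M p D i n) \<phi> b"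
  shows "mean_le (node_bookings M p D i s) \<phi> (b + \<bar>real s - real n\<bar>)"
proof -
  have step: "\<bar>\<phi> (case k of None \<Rightarrow> Y | Some j \<Rightarrow> Y(j := Suc (Y j))) - \<phi> Y\<bar> \<le> 1" for k Y
  proof (cases k)
    case (Some j)
    show ?thesis
    proof (cases "j \<in> out_nbrs M i")
      case True
      then show ?thesis using Some by (simp add: \<phi>_def sum.remove[of _ j])
    next
      case False
      then have "\<phi> (Y(j := Suc (Y j))) = \<phi> Y" unfolding \<phi>_def by (intro sum.cong) auto
      then show ?thesis using Some by simp
    qed
  qed simp
  have up: "mean_le (node_bookings M p D i (Suc s)) \<phi> (b + 1)"
    if "mean_le (node_bookings M p D i s) \<phi> b" for s b
  proof -
    have "mean_le (node_bookings M p D i s) (\<lambda>Y. \<phi> Y + 1) (b + 1)"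
      by (intro mean_le_add that) (auto intro: mean_le_const)
    moreover have "mean_le q (\<lambda>k. \<phi> (case k of None \<Rightarrow> Y | Some j \<Rightarrow> Y(j := Suc (Y j)))) (\<phi> Y + 1)" for q Y
    proof (rule mean_le_const)
      show "\<phi> (case k of None \<Rightarrow> Y | Some j \<Rightarrow> Y(j := Suc (Y j))) \<le> \<phi> Y + 1" for k
        using step[of Y k] by linarith
      show "0 \<le> \<phi> Y + 1" unfolding \<phi>_def by (simp add: sum_nonneg add_nonneg_nonneg)
    qed
    ultimately show ?thesis
      by (auto intro: mean_le_bind[where g = "\<lambda>Y. \<phi> Y + 1"])
  qed
  have down: "mean_le (node_bookings M p D i s) \<phi> (b + 1)"
    if "mean_le (node_bookings M p D i (Suc s)) \<phi> b" for s b
  proof -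
    have "mean_le (node_bookings M p D i s) (\<lambda>Y. \<phi> Y - 1) b"
    proof (rule mean_le_bind_reverse)
      show "mean_le (bind_pmf (node_bookings M p D i s) (\<lambda>Y. map_pmf
        (\<lambda>c. case c of None \<Rightarrow> Y | Some j \<Rightarrow> Y(j := Suc (Y j)))
         (choice_pmf M p i {j \<in> out_nbrs M i. Y j < D (i, j)}))) \<phi> b"
        using that by simp
      fix Y Y'
      assume "Y' \<in> set_pmf (map_pmf
        (\<lambda>c. case c of None \<Rightarrow> Y | Some j \<Rightarrow> Y(j := Suc (Y j)))
         (choice_pmf M p i {j \<in> out_nbrs M i. Y j < D (i, j)}))"
      then obtain k where "Y' = (case k of None \<Rightarrow> Y | Some j \<Rightarrow> Y(j := Suc (Y j)))" by auto
      with step[of Y k] show "\<phi> Y - 1 \<le> \<phi> Y'" by simp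
    qed
    then have "mean_le (node_bookings M p D i s) (\<lambda>Y. (\<phi> Y - 1) + 1) (b + 1)"
      by (intro mean_le_add) (auto intro: mean_le_const)
    then show ?thesis by simp
  qed
  have ups: "mean_le (node_bookings M p D i (m + k)) \<phi> (b + real k)"
    if "mean_le (node_bookings M p D i m) \<phi> b" for m k b
  proof (induction k)
    case (Suc k)
    from up[OF this] show ?case by (simp add: algebra_simps)
  qed (use that in simp)
  have downs: "mean_le (node_bookings M p D i m) \<phi> (b + real k)"
    if "mean_le (node_bookings M p D i (m + k)) \<phi> b" for m k b
    using that
  proof (induction k arbitrary: b)
    case (Suc k)
    then have "mean_le (node_bookings M p D i (m + k)) \<phi> (b + 1)" by (intro down) simp
    from Suc.IH[OF this] show ?case by (simp add: algebra_simps)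
  qed simp
  show ?thesis
  proof (cases "n \<le> s")
    case True
    with ups[OF assms(2), of "s - n"] show ?thesis by simp
  next
    case False
    with downs[of s "n - s" b] assms(2) show ?thesis by simp
  qed
qed

text \<open>
  The deviation is computed for \<open>n\<close> carriers, the fluid supply \<open>\<theta> * T\<close> rounded down, and transferred to
  \<open>s\<close> carriers by the Lipschitz bound. For \<open>n\<close> carriers, every lane and the outside option have a
  deficit of order \<open>sqrt \<theta>\<close>, apart from a shortage of loads; since the counts add up to
  \<open>n \<le> \<theta> * T\<close>, the total surplus on lanes is at most the total deficit, whence the factor two.
\<close>

lemma node_deviation:
  fixes M :: "'n::finite market" and y d :: "'n \<Rightarrow> real" and v \<theta> :: real and i :: 'n
  defines "N \<equiv> out_nbrs M i"
  defines "T \<equiv> v + sum y N"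
  assumes v: "0 < v" and \<theta>: "1 \<le> \<theta>"
    and y: "\<And>j. j \<in> N \<Longrightarrow> 0 \<le> y j \<and> y j \<le> d j"
    and w: "\<And>j. j \<in> N \<Longrightarrow> 0 < D (i, j) \<Longrightarrow> choice_weight M p i j = y j / v"
  shows "mean_le (node_bookings M p D i s) (\<lambda>Y. \<Sum>j\<in>N. \<bar>real (Y j) - \<theta> * y j\<bar>)
    (\<bar>real s - \<theta> * T\<bar> + (\<Sum>j\<in>N. 2 * max 0 (\<theta> * d j - real (D (i, j))))
      + ((2 * real (card N) + 1) * (1 + (T + 1) / 2) + 1) * sqrt \<theta>)"
proof -
  (* rounding down makes the total count at most the total target, so surplus is covered by deficit *)
  define n where "n = nat \<lfloor>\<theta> * T\<rfloor>"
  have sum_y: "0 \<le> sum y N" using y by (intro sum_nonneg) auto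
  have T: "0 < T" using v sum_y by (simp add: T_def)
  have n: "real n \<le> \<theta> * T" "\<theta> * T < real n + 1"
    using T \<theta> by (simp_all add: n_def)
  have sqrt1: "1 \<le> sqrt \<theta>" using \<theta> by simp
  define c where "c = sqrt \<theta> * (T + 1) / 2"
  have W: "0 < 1 + sum (choice_weight M p i) A" "1 + sum (choice_weight M p i) A \<le> T / v"
    if "A \<subseteq> {k \<in> N. 0 < D (i, k)}" for A
  proof -
    show "0 < 1 + sum (choice_weight M p i) A"
      by (intro add_pos_nonneg sum_nonneg) (auto simp: choice_weight_def)
    have "sum (choice_weight M p i) A = (\<Sum>k\<in>A. y k / v)"
      using that w by (intro sum.cong) auto
    also have "\<dots> \<le> (\<Sum>k\<in>N. y k / v)"
      using that y v by (intro sum_mono2) auto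
    finally show "1 + sum (choice_weight M p i) A \<le> T / v"
      using v by (simp add: T_def sum_divide_distrib add_divide_distrib)
  qed
  have lane: "mean_le (node_bookings M p D i n) (\<lambda>Y. max 0 (\<theta> * y j - real (Y j)))
      (1 + max 0 (\<theta> * d j - real (D (i, j))) + c)" if j: "j \<in> N" for j
  proof -
    define G where "G Y = max 0 (min (y j / T * real n) (real (D (i, j))) - real (Y j))" for Y :: "'n \<Rightarrow> nat"
    have "mean_le (node_bookings M p D i n) (\<lambda>Y. (G Y)\<^sup>2) (real n)"
      unfolding G_def
    proof (rule lane_deficit)
      show "j \<in> out_nbrs M i" using j by (simp add: N_def)
      show "0 \<le> y j / T" using y[OF j] T by simp
      fix A assume A: "j \<in> A" "A \<subseteq> {k \<in> out_nbrs M i. 0 < D (i, k)}"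
      then have "choice_weight M p i j = y j / v" using w j by auto
      moreover have "y j / v / (T / v) \<le> y j / v / (1 + sum (choice_weight M p i) A)"
        using W[of A] A y[OF j] v T by (intro divide_left_mono) (auto simp: N_def)
      ultimately show "y j / T \<le> pmf (choice_pmf M p i A) (Some j)"
        using A v by (simp add: pmf_choice)
    qed
    then have "mean_le (node_bookings M p D i n) (\<lambda>Y. (G Y)\<^sup>2) (\<theta> * T)"
      by (rule mean_le_mono) (use n in auto)
    then have "mean_le (node_bookings M p D i n) (\<lambda>Y. \<bar>G Y\<bar>) c"
      unfolding c_def by (rule mean_le_abs_of_square) (use \<theta> in auto)
    then have "mean_le (node_bookings M p D i n)
        (\<lambda>Y. 1 + max 0 (\<theta> * d j - real (D (i, j))) + \<bar>G Y\<bar>) (1 + max 0 (\<theta> * d j - real (D (i, j))) + c)"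
      by (intro mean_le_add) (auto intro: mean_le_const)
    then show ?thesis
    proof (rule mean_le_mono)
      fix Y
      have "\<theta> * y j \<le> y j / T * real n + 1"
      proof -
        have "y j / T \<le> 1"
          using y[OF j] T v member_le_sum[OF j, of y] y by (simp add: T_def N_def[symmetric])
        moreover have "\<theta> * y j = y j / T * (\<theta> * T)" using T by simp
        moreover have "y j / T * (\<theta> * T) \<le> y j / T * (real n + 1)"
          using n y[OF j] T by (intro mult_left_mono) auto
        moreover have "y j / T * (real n + 1) = y j / T * real n + y j / T"
          by (simp only: distrib_left mult_1_right)
        ultimately show ?thesis by linarith
      qed
      moreover have "\<theta> * y j \<le> \<theta> * d j" using y[OF j] \<theta> by simp
      ultimately show "max 0 (\<theta> * y j - real (Y j)) \<le> 1 + max 0 (\<theta> * d j - real (D (i, j))) + \<bar>G Y\<bar>"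
        unfolding G_def by linarith
    qed simp
  qed
  have outside: "mean_le (node_bookings M p D i n)
      (\<lambda>Y. max 0 (\<theta> * v - (real n - (\<Sum>j\<in>N. real (Y j))))) (1 + c)"
  proof -
    define G where "G Y = max 0 (v / T * real n - (real n - (\<Sum>j\<in>N. real (Y j))))" for Y :: "'n \<Rightarrow> nat"
    have "mean_le (node_bookings M p D i n) (\<lambda>Y. (G Y)\<^sup>2) (real n)"
      unfolding G_def N_def
    proof (rule outside_deficit)
      show "0 \<le> v / T" using v T by simp
      fix A assume A: "A \<subseteq> {k \<in> out_nbrs M i. 0 < D (i, k)}"
      have "1 / (T / v) \<le> 1 / (1 + sum (choice_weight M p i) A)"
        using W[of A] A v T by (intro divide_left_mono) (auto simp: N_def)
      then show "v / T \<le> pmf (choice_pmf M p i A) None"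
        by (simp add: pmf_choice)
    qed
    then have "mean_le (node_bookings M p D i n) (\<lambda>Y. (G Y)\<^sup>2) (\<theta> * T)"
      by (rule mean_le_mono) (use n in auto)
    then have "mean_le (node_bookings M p D i n) (\<lambda>Y. \<bar>G Y\<bar>) c"
      unfolding c_def by (rule mean_le_abs_of_square) (use \<theta> in auto)
    then have "mean_le (node_bookings M p D i n) (\<lambda>Y. 1 + \<bar>G Y\<bar>) (1 + c)"
      by (intro mean_le_add) (auto intro: mean_le_const)
    then show ?thesis
    proof (rule mean_le_mono)
      fix Y
      have "\<theta> * v \<le> v / T * real n + 1"
      proof -
        have "\<theta> * v = v / T * (\<theta> * T)" using T by simp
        also have "\<dots> \<le> v / T * (real n + 1)"
          using n v T by (intro mult_left_mono) auto
        also have "v / T * 1 \<le> 1" using T sum_y by (simp add: T_def)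
        ultimately show ?thesis by (simp add: algebra_simps)
      qed
      then show "max 0 (\<theta> * v - (real n - (\<Sum>j\<in>N. real (Y j)))) \<le> 1 + \<bar>G Y\<bar>"
        unfolding G_def by linarith
    qed simp
  qed
  have "mean_le (node_bookings M p D i n)
      (\<lambda>Y. 2 * (\<Sum>j\<in>N. max 0 (\<theta> * y j - real (Y j))) + max 0 (\<theta> * v - (real n - (\<Sum>j\<in>N. real (Y j)))))
      (2 * (\<Sum>j\<in>N. 1 + max 0 (\<theta> * d j - real (D (i, j))) + c) + (1 + c))"
    by (intro mean_le_add mean_le_cmult mean_le_sum lane outside) auto
  then have "mean_le (node_bookings M p D i n) (\<lambda>Y. \<Sum>j\<in>N. \<bar>real (Y j) - \<theta> * y j\<bar>)
      (2 * (\<Sum>j\<in>N. 1 + max 0 (\<theta> * d j - real (D (i, j))) + c) + (1 + c))"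
  proof (rule mean_le_mono)
    fix Y
    have "(\<Sum>j\<in>N. \<bar>real (Y j) - \<theta> * y j\<bar>)
        = (\<Sum>j\<in>N. 2 * max 0 (\<theta> * y j - real (Y j)) + (real (Y j) - \<theta> * y j))"
      by (intro sum.cong) (auto simp: abs_if max_def)
    also have "\<dots> = 2 * (\<Sum>j\<in>N. max 0 (\<theta> * y j - real (Y j))) + ((\<Sum>j\<in>N. real (Y j)) - \<theta> * sum y N)"
      by (simp add: sum.distrib sum_distrib_left sum_subtractf)
    also have "(\<Sum>j\<in>N. real (Y j)) - \<theta> * sum y N \<le> \<theta> * v - (real n - (\<Sum>j\<in>N. real (Y j)))"
      using n by (simp add: T_def algebra_simps)
    finally show "(\<Sum>j\<in>N. \<bar>real (Y j) - \<theta> * y j\<bar>) \<le> 2 * (\<Sum>j\<in>N. max 0 (\<theta> * y j - real (Y j)))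
        + max 0 (\<theta> * v - (real n - (\<Sum>j\<in>N. real (Y j))))"
      by simp
  qed simp
  from node_bookings_lipschitz[OF this[unfolded N_def], of s, folded N_def]
  show ?thesis
  proof (rule mean_le_mono)
    define K where "K = (2 * real (card N) + 1) * (1 + (T + 1) / 2)"
    have "2 * (\<Sum>j\<in>N. 1 + max 0 (\<theta> * d j - real (D (i, j))) + c) + (1 + c)
        = (\<Sum>j\<in>N. 2 * max 0 (\<theta> * d j - real (D (i, j)))) + (2 * real (card N) + 1) * (1 + c)"
      by (simp add: sum.distrib sum_distrib_left algebra_simps)
    moreover have "(2 * real (card N) + 1) * (1 + c) \<le> (2 * real (card N) + 1) * ((1 + (T + 1) / 2) * sqrt \<theta>)"
      using sqrt1 by (intro mult_left_mono) (auto simp: c_def algebra_simps)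
    moreover have "(2 * real (card N) + 1) * ((1 + (T + 1) / 2) * sqrt \<theta>) = K * sqrt \<theta>"
      by (simp add: K_def)
    moreover have "\<bar>real s - real n\<bar> \<le> \<bar>real s - \<theta> * T\<bar> + 1" using n by linarith
    moreover have "(K + 1) * sqrt \<theta> = K * sqrt \<theta> + sqrt \<theta>" by (simp add: algebra_simps)
    ultimately show "2 * (\<Sum>j\<in>N. 1 + max 0 (\<theta> * d j - real (D (i, j))) + c) + (1 + c) + \<bar>real s - real n\<bar>
      \<le> \<bar>real s - \<theta> * T\<bar> + (\<Sum>j\<in>N. 2 * max 0 (\<theta> * d j - real (D (i, j))))
        + ((2 * real (card N) + 1) * (1 + (T + 1) / 2) + 1) * sqrt \<theta>"
      unfolding K_def[symmetric] using sqrt1 by (smt (verit))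
  qed simp
qed

section \<open>The supply chain under posted prices\<close>

definition load_pmf :: "'n::finite market \<Rightarrow> ('n \<times> 'n \<Rightarrow> real) \<Rightarrow> ('n \<times> 'n \<Rightarrow> nat) pmf" where
  "load_pmf M r = Pi_pmf (lanes M) 0 (\<lambda>e. poisson_dist (demand M e (r e)))"

definition arrivals_after ::
  "'n::finite market \<Rightarrow> ('n \<times> 'n \<Rightarrow> nat) \<Rightarrow> ('n \<Rightarrow> nat) pmf" where
  "arrivals_after M Y =
     bind_pmf (Pi_pmf (lanes M) 0 (\<lambda>e. binomial_pmf (Y e) (stay_prob M e))) (\<lambda>Z.
     map_pmf (\<lambda>L j. (\<Sum>i\<in>in_nbrs M j. Z (i, j)) + L j)
       (Pi_pmf UNIV 0 (\<lambda>j. poisson_dist (arrival_rate M j))))"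

definition next_supply ::
  "'n::finite market \<Rightarrow> ('n \<times> 'n \<Rightarrow> real) \<Rightarrow> ('n \<Rightarrow> nat) \<Rightarrow> ('n \<times> 'n \<Rightarrow> nat) \<Rightarrow> ('n \<Rightarrow> nat) pmf" where
  "next_supply M p S D = bind_pmf (bookings M p S D) (arrivals_after M)"

text \<open>
  Drawing the loads as part of the step turns the supply alone into a Markov chain.
\<close>

definition supply_step ::
  "'n::finite market \<Rightarrow> ('n \<times> 'n \<Rightarrow> real) \<Rightarrow> ('n \<times> 'n \<Rightarrow> real) \<Rightarrow> ('n \<Rightarrow> nat) \<Rightarrow> ('n \<Rightarrow> nat) pmf" where
  "supply_step M r p S = bind_pmf (load_pmf M r) (next_supply M p S)"

lemma transition_eq:
  "transition M r p (S, D) = pair_pmf (next_supply M p S D) (load_pmf M r)"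
  by (simp add: transition_def next_supply_def arrivals_after_def load_pmf_def pair_pmf_def
        bind_assoc_pmf map_pmf_def bind_return_pmf)

text \<open>
  From the first transition on, loads are independent of supply and identically distributed, so the
  pair chain is determined by the supply chain. The initial loads enter only through the
  starting distribution \<open>next_supply M p S D\<close>.
\<close>

lemma state_pmf_Suc_eq:
  "state_pmf M r p (S, D) (Suc t) =
    pair_pmf (((\<lambda>\<rho>. bind_pmf \<rho> (supply_step M r p)) ^^ t) (next_supply M p S D)) (load_pmf M r)"
proof (induction t)
  case 0
  show ?case by (simp add: bind_return_pmf transition_eq)
next
  case (Suc t)
  let ?\<sigma> = "((\<lambda>\<rho>. bind_pmf \<rho> (supply_step M r p)) ^^ t) (next_supply M p S D)"
  have "state_pmf M r p (S, D) (Suc (Suc t)) = bind_pmf (pair_pmf ?\<sigma> (load_pmf M r)) (transition M r p)"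
    using Suc by simp
  also have "\<dots> = bind_pmf ?\<sigma> (\<lambda>S. bind_pmf (load_pmf M r) (\<lambda>D. transition M r p (S, D)))"
    by (simp add: pair_pmf_def bind_assoc_pmf bind_return_pmf)
  also have "\<dots> = pair_pmf (bind_pmf ?\<sigma> (supply_step M r p)) (load_pmf M r)"
    by (simp add: transition_eq supply_step_def[abs_def] pair_pmf_def bind_assoc_pmf)
  finally show ?case by simp
qed

text \<open>
  Nodes book independently, so each marginal is the process of a single node.
\<close>

lemma bookings_node: "map_pmf (\<lambda>Y j. Y (i, j)) (bookings M p S D) = node_bookings M p D i (S i)"
proof -
  have "map_pmf (\<lambda>Y j. Y (i, j)) (bookings M p S D)
      = map_pmf (\<lambda>Y. Y i) (Pi_pmf UNIV (\<lambda>_. 0) (\<lambda>i. node_bookings M p D i (S i)))"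
    by (simp add: bookings_def map_pmf_comp)
  then show ?thesis by (simp add: Pi_pmf_component)
qed

lemma bookings_support:
  assumes "Y \<in> set_pmf (bookings M p S D)"
  shows "Y e \<le> D e" and "e \<notin> lanes M \<Longrightarrow> Y e = 0"
proof -
  obtain i j where e: "e = (i, j)" by force
  have "(\<lambda>j. Y (i, j)) \<in> set_pmf (node_bookings M p D i (S i))"
    unfolding bookings_node[symmetric] using assms by auto
  from node_bookings_support(1)[OF this, of j] node_bookings_support(2)[OF this, of j]
  show "Y e \<le> D e" and "e \<notin> lanes M \<Longrightarrow> Y e = 0" by (auto simp: e out_nbrs_def)
qed

lemma bookings_no_load: "bookings M p S (\<lambda>_. 0) = return_pmf (\<lambda>_. 0)"
proof -
  have "set_pmf (bookings M p S (\<lambda>_. 0)) \<subseteq> {\<lambda>_. 0}"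
    using bookings_support(1)[of _ M p S "\<lambda>_. 0"] by auto
  then show ?thesis by (simp add: set_pmf_subset_singleton)
qed

definition served ::
  "'n::finite market \<Rightarrow> ('n \<times> 'n \<Rightarrow> real) \<Rightarrow> ('n \<Rightarrow> nat) \<Rightarrow> ('n \<times> 'n \<Rightarrow> nat) \<Rightarrow> 'n \<times> 'n \<Rightarrow> real" where
  "served M p S D e = measure_pmf.expectation (bookings M p S D) (\<lambda>Y. real (Y e))"

lemma integrable_bookings: "integrable (measure_pmf (bookings M p S D)) (\<lambda>Y. real (Y e))"
  by (rule measure_pmf.integrable_const_bound[where B = "real (D e)"])
     (auto simp: AE_measure_pmf_iff bookings_support)

lemma served_bounds: "0 \<le> served M p S D e" "served M p S D e \<le> real (D e)"
  unfolding served_def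
  by (auto intro!: measure_pmf.integral_le_const integrable_bookings
        simp: AE_measure_pmf_iff bookings_support)

lemma expectation_affine:
  fixes f :: "'a \<Rightarrow> real"
  assumes "integrable (measure_pmf q) f"
  shows "integrable (measure_pmf q) (\<lambda>x. a + b * f x)"
    and "measure_pmf.expectation q (\<lambda>x. a + b * f x) = a + b * measure_pmf.expectation q f"
  using assms by (auto intro!: Bochner_Integration.integrable_add integrable_mult_right)

lemma period_profit_eq:
  "period_profit M r p (S, D) = (\<Sum>e\<in>lanes M. r e * demand M e (r e) - penalty M e * real (D e)
     + (penalty M e - p e) * served M p S D e)"
proof -
  have "period_profit M r p (S, D) = measure_pmf.expectation (bookings M p S D) (\<lambda>Y.
    \<Sum>e\<in>lanes M. (r e * demand M e (r e) - penalty M e * real (D e)) + (penalty M e - p e) * real (Y e))"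
    by (simp add: period_profit_def algebra_simps)
  also have "\<dots> = (\<Sum>e\<in>lanes M. (r e * demand M e (r e) - penalty M e * real (D e))
      + (penalty M e - p e) * served M p S D e)"
    unfolding served_def
    by (subst Bochner_Integration.integral_sum)
       (intro sum.cong refl expectation_affine integrable_bookings)+
  finally show ?thesis .
qed

definition mean_served ::
  "'n::finite market \<Rightarrow> ('n \<times> 'n \<Rightarrow> real) \<Rightarrow> ('n \<times> 'n \<Rightarrow> real) \<Rightarrow> ('n \<Rightarrow> nat) \<Rightarrow> 'n \<times> 'n \<Rightarrow> real" where
  "mean_served M r p S e = measure_pmf.expectation (load_pmf M r) (\<lambda>D. served M p S D e)"

text \<open>
  The mean of \<open>period_profit\<close> over fresh loads, written as an affine function of mean bookings so that
  only these have to be estimated.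
\<close>

definition supply_profit ::
  "'n::finite market \<Rightarrow> ('n \<times> 'n \<Rightarrow> real) \<Rightarrow> ('n \<times> 'n \<Rightarrow> real) \<Rightarrow> ('n \<Rightarrow> nat) \<Rightarrow> real" where
  "supply_profit M r p S = (\<Sum>e\<in>lanes M. (r e - penalty M e) * demand M e (r e)
     + (penalty M e - p e) * mean_served M r p S e)"

locale priced_market =
  fixes M :: "'n::finite market" and r p :: "'n \<times> 'n \<Rightarrow> real"
  assumes demand_nonneg: "e \<in> lanes M \<Longrightarrow> 0 \<le> demand M e (r e)"
begin

lemma load_component:
  assumes "e \<in> lanes M"
  shows "map_pmf (\<lambda>D. D e) (load_pmf M r) = poisson_dist (demand M e (r e))"
  using assms by (simp add: load_pmf_def Pi_pmf_component)

lemma load_nn_integral: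
  assumes "e \<in> lanes M"
  shows "(\<integral>\<^sup>+D. ennreal (real (D e)) \<partial>measure_pmf (load_pmf M r)) = ennreal (demand M e (r e))"
  using poisson_mean[OF demand_nonneg[OF assms]]
  unfolding load_component[OF assms, symmetric] by simp

lemma load_expectation:
  assumes "e \<in> lanes M"
  shows "integrable (measure_pmf (load_pmf M r)) (\<lambda>D. real (D e))"
    and "measure_pmf.expectation (load_pmf M r) (\<lambda>D. real (D e)) = demand M e (r e)"
  using load_nn_integral[OF assms] demand_nonneg[OF assms]
  by (auto simp: integral_eq_nn_integral intro!: integrableI_nonneg)

text \<open>
  The regeneration event of the supply chain.
\<close>

lemma load_zero_pos: "0 < pmf (load_pmf M r) (\<lambda>_. 0)"
proof -
  have "0 < pmf (poisson_dist (demand M e (r e))) 0" if "e \<in> lanes M" for e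
    using demand_nonneg[OF that] by (auto simp: poisson_dist_def)
  then have "0 < (\<Prod>e\<in>lanes M. pmf (poisson_dist (demand M e (r e))) 0)"
    by (intro prod_pos) auto
  then show ?thesis by (simp add: load_pmf_def pmf_Pi)
qed

lemma mean_served_bounds:
  assumes "e \<in> lanes M"
  shows "0 \<le> mean_served M r p S e" "mean_served M r p S e \<le> demand M e (r e)"
proof -
  show "0 \<le> mean_served M r p S e" unfolding mean_served_def by (simp add: served_bounds)
  have "mean_served M r p S e \<le> measure_pmf.expectation (load_pmf M r) (\<lambda>D. real (D e))"
    unfolding mean_served_def
    by (intro integral_mono Bochner_Integration.integrable_bound[OF load_expectation(1)[OF assms]]
          load_expectation(1)[OF assms]) (auto simp: served_bounds)
  then show "mean_served M r p S e \<le> demand M e (r e)" by (simp add: load_expectation[OF assms])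
qed

text \<open>
  Loads and bookings have finite means, so the expectation over the pair can be taken lane by lane
  and then in iterated form.
\<close>

lemma period_profit_expectation:
  "measure_pmf.expectation (pair_pmf \<sigma> (load_pmf M r)) (period_profit M r p)
    = measure_pmf.expectation \<sigma> (supply_profit M r p)"
proof -
  let ?P = "pair_pmf \<sigma> (load_pmf M r)"
  have load: "integrable (measure_pmf ?P) (\<lambda>x. real (snd x e))"
    "measure_pmf.expectation ?P (\<lambda>x. real (snd x e)) = demand M e (r e)" if "e \<in> lanes M" for e
  proof -
    have "integrable (map_pmf snd ?P) (\<lambda>D. real (D e))"
      "measure_pmf.expectation (map_pmf snd ?P) (\<lambda>D. real (D e)) = demand M e (r e)"
      unfolding map_snd_pair_pmf by (rule load_expectation[OF that])+
    then show "integrable (measure_pmf ?P) (\<lambda>x. real (snd x e))"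
      "measure_pmf.expectation ?P (\<lambda>x. real (snd x e)) = demand M e (r e)"
      by simp_all
  qed
  have int: "integrable (measure_pmf ?P) (\<lambda>x. served M p (fst x) (snd x) e)" if "e \<in> lanes M" for e
    by (rule Bochner_Integration.integrable_bound[OF load(1)[OF that]]) (auto simp: served_bounds)
  have served: "measure_pmf.expectation ?P (\<lambda>x. served M p (fst x) (snd x) e)
      = measure_pmf.expectation \<sigma> (\<lambda>S. mean_served M r p S e)" if "e \<in> lanes M" for e
  proof -
    have P: "?P = bind_pmf \<sigma> (\<lambda>S. map_pmf (Pair S) (load_pmf M r))"
      by (simp add: pair_pmf_def map_pmf_def)
    show ?thesis
      using int[OF that] unfolding P
      by (subst expectation_bind) (auto simp: served_bounds mean_served_def)
  qed
  have int': "integrable (measure_pmf \<sigma>) (\<lambda>S. mean_served M r p S e)" if "e \<in> lanes M" for e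
    using mean_served_bounds[OF that] by (intro integrable_bounded_pmf[where B = "demand M e (r e)"]) auto
  have "measure_pmf.expectation ?P (period_profit M r p)
      = measure_pmf.expectation ?P (\<lambda>x. \<Sum>e\<in>lanes M. r e * demand M e (r e)
          - penalty M e * real (snd x e) + (penalty M e - p e) * served M p (fst x) (snd x) e)"
    by (intro Bochner_Integration.integral_cong refl) (auto simp: period_profit_eq)
  also have "\<dots> = (\<Sum>e\<in>lanes M. measure_pmf.expectation ?P (\<lambda>x. r e * demand M e (r e)
      - penalty M e * real (snd x e) + (penalty M e - p e) * served M p (fst x) (snd x) e))"
    using load(1) int
    by (intro Bochner_Integration.integral_sum Bochner_Integration.integrable_add
          Bochner_Integration.integrable_diff integrable_mult_right) auto
  also have "\<dots> = (\<Sum>e\<in>lanes M. (r e - penalty M e) * demand M e (r e)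
      + (penalty M e - p e) * measure_pmf.expectation \<sigma> (\<lambda>S. mean_served M r p S e))"
  proof (rule sum.cong[OF refl])
    fix e assume e: "e \<in> lanes M"
    have "measure_pmf.expectation ?P (\<lambda>x. r e * demand M e (r e)
        - penalty M e * real (snd x e) + (penalty M e - p e) * served M p (fst x) (snd x) e)
      = measure_pmf.expectation ?P (\<lambda>x. r e * demand M e (r e) + (- penalty M e) * real (snd x e))
        + measure_pmf.expectation ?P (\<lambda>x. 0 + (penalty M e - p e) * served M p (fst x) (snd x) e)"
      unfolding Bochner_Integration.integral_add[OF expectation_affine(1)[OF load(1)[OF e]]
          expectation_affine(1)[OF int[OF e]], symmetric] by simp
    then show "measure_pmf.expectation ?P (\<lambda>x. r e * demand M e (r e)
        - penalty M e * real (snd x e) + (penalty M e - p e) * served M p (fst x) (snd x) e)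
      = (r e - penalty M e) * demand M e (r e)
        + (penalty M e - p e) * measure_pmf.expectation \<sigma> (\<lambda>S. mean_served M r p S e)"
      unfolding expectation_affine(2)[OF load(1)[OF e]] expectation_affine(2)[OF int[OF e]]
        load(2)[OF e] served[OF e]
      by (simp add: algebra_simps)
  qed
  also have "\<dots> = measure_pmf.expectation \<sigma> (supply_profit M r p)"
    unfolding supply_profit_def[abs_def]
    by (subst Bochner_Integration.integral_sum)
       (auto intro!: sum.cong expectation_affine(1)[OF int'] expectation_affine(2)[OF int', symmetric])
  finally show ?thesis .
qed

text \<open>
  Although the profit of a period is unbounded in the loads, its mean given the supply is bounded,
  because mean bookings never exceed mean loads. This makes the convergence result for bounded
  rewards applicable.
\<close>

lemma supply_profit_bounded: "\<exists>B. \<forall>S. \<bar>supply_profit M r p S\<bar> \<le> B"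
proof (intro exI allI)
  fix S
  show "\<bar>supply_profit M r p S\<bar> \<le> (\<Sum>e\<in>lanes M. \<bar>(r e - penalty M e) * demand M e (r e)\<bar>
    + \<bar>penalty M e - p e\<bar> * demand M e (r e))"
    unfolding supply_profit_def
  proof (rule order_trans[OF sum_abs], rule sum_mono)
    fix e assume "e \<in> lanes M"
    with mean_served_bounds[of e S]
    have "\<bar>(penalty M e - p e) * mean_served M r p S e\<bar> \<le> \<bar>penalty M e - p e\<bar> * demand M e (r e)"
      unfolding abs_mult by (intro mult_left_mono) auto
    then show "\<bar>(r e - penalty M e) * demand M e (r e) + (penalty M e - p e) * mean_served M r p S e\<bar>
      \<le> \<bar>(r e - penalty M e) * demand M e (r e)\<bar> + \<bar>penalty M e - p e\<bar> * demand M e (r e)"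
      by linarith
  qed
qed

lemma average_profit_converges:
  "\<exists>g. (\<forall>\<sigma>. (\<lambda>t. measure_pmf.expectation (((\<lambda>\<rho>. bind_pmf \<rho> (supply_step M r p)) ^^ t) \<sigma>)
      (supply_profit M r p)) \<longlonglongrightarrow> g) \<and> (\<forall>x. average_profit M r p x \<longlonglongrightarrow> g)"
proof -
  obtain B where B: "\<And>S. \<bar>supply_profit M r p S\<bar> \<le> B" using supply_profit_bounded by blast
  have "next_supply M p S (\<lambda>_. 0) = next_supply M p S' (\<lambda>_. 0)" for S S'
    by (simp add: next_supply_def bookings_no_load bind_return_pmf)
  from doeblin_convergence[of "load_pmf M r" "\<lambda>_. 0" "next_supply M p" "supply_profit M r p", OF load_zero_pos this B]
  obtain g where g: "(\<lambda>t. measure_pmf.expectation (((\<lambda>\<rho>. bind_pmf \<rho> (supply_step M r p)) ^^ t) \<sigma>)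
      (supply_profit M r p)) \<longlonglongrightarrow> g" for \<sigma>
    unfolding supply_step_def[abs_def] by blast
  have "average_profit M r p (S, D) \<longlonglongrightarrow> g" for S D
    unfolding average_profit_def[abs_def]
  proof (rule cesaro_mean_tendsto, rule LIMSEQ_offset[of _ 1])
    show "(\<lambda>n. measure_pmf.expectation (state_pmf M r p (S, D) (n + 1)) (period_profit M r p)) \<longlonglongrightarrow> g"
      unfolding Suc_eq_plus1[symmetric] state_pmf_Suc_eq period_profit_expectation by (rule g)
  qed
  with g show ?thesis by (intro exI[of _ g]) auto
qed

lemma long_run_profit_eq:
  assumes "\<And>x. average_profit M r p x \<longlonglongrightarrow> g"
  shows "long_run_profit M r p = g"
  unfolding long_run_profit_def
  using assms LIMSEQ_unique by (intro the_equality) blast+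

lemma long_run_profit_limit:
  "average_profit M r p x \<longlonglongrightarrow> long_run_profit M r p"
  "(\<lambda>t. measure_pmf.expectation (((\<lambda>\<rho>. bind_pmf \<rho> (supply_step M r p)) ^^ t) \<sigma>)
      (supply_profit M r p)) \<longlonglongrightarrow> long_run_profit M r p"
  using average_profit_converges long_run_profit_eq by blast+

end

section \<open>Contraction towards the fluid supply\<close>

lemma sum_over_tails:
  fixes M :: "'n::finite market" and f :: "'n \<times> 'n \<Rightarrow> real"
  shows "(\<Sum>i\<in>UNIV. \<Sum>j\<in>out_nbrs M i. f (i, j)) = sum f (lanes M)"
proof -
  have "Sigma UNIV (out_nbrs M) = lanes M" by (auto simp: out_nbrs_def)
  then show ?thesis using sum.Sigma[of UNIV "out_nbrs M" "\<lambda>i j. f (i, j)"] by simp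
qed

lemma sum_over_heads:
  fixes M :: "'n::finite market" and f :: "'n \<times> 'n \<Rightarrow> real"
  shows "(\<Sum>j\<in>UNIV. \<Sum>i\<in>in_nbrs M j. f (i, j)) = sum f (lanes M)"
proof -
  have "lanes M = prod.swap ` Sigma UNIV (in_nbrs M)" by (force simp: in_nbrs_def)
  then have "sum f (lanes M) = (\<Sum>x\<in>Sigma UNIV (in_nbrs M). f (prod.swap x))"
    by (simp add: sum.reindex inj_on_def)
  then show ?thesis
    using sum.Sigma[of UNIV "in_nbrs M" "\<lambda>j i. f (i, j)"] by (simp add: split_beta prod.swap_def)
qed

lemma scale_simps [simp]:
  "lanes (scale \<theta> M) = lanes M" "penalty (scale \<theta> M) = penalty M"
  "stay_prob (scale \<theta> M) = stay_prob M" "disutility (scale \<theta> M) = disutility M"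
  "sensitivity (scale \<theta> M) = sensitivity M" "prices (scale \<theta> M) = prices M"
  "demand (scale \<theta> M) e x = real \<theta> * demand M e x"
  "arrival_rate (scale \<theta> M) i = real \<theta> * arrival_rate M i"
  "out_nbrs (scale \<theta> M) = out_nbrs M" "in_nbrs (scale \<theta> M) = in_nbrs M"
  by (simp_all add: scale_def out_nbrs_def[abs_def] in_nbrs_def[abs_def])

text \<open>
  What the stochastic analysis uses of an optimal fluid solution.
\<close>

locale fluid_solution =
  fixes M :: "'n::finite market" and d y :: "'n \<times> 'n \<Rightarrow> real" and v :: "'n \<Rightarrow> real"
  assumes sensitivity_pos: "0 < sensitivity M"
    and stay_prob: "e \<in> lanes M \<Longrightarrow> 0 < stay_prob M e \<and> stay_prob M e < 1"
    and lanes_nonempty: "lanes M \<noteq> {}"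
    and arrival_pos: "0 < arrival_rate M i"
    and demand_price: "e \<in> lanes M \<Longrightarrow> demand M e (SP_shipper_price M d e) = d e"
    and flow: "e \<in> lanes M \<Longrightarrow> 0 \<le> y e \<and> y e \<le> d e"
    and flow_pos: "e \<in> lanes M \<Longrightarrow> 0 < d e \<Longrightarrow> 0 < y e"
    and outflow_pos: "0 < v i"
    and balance: "(\<Sum>i\<in>in_nbrs M j. stay_prob M (i, j) * y (i, j)) + arrival_rate M j
      = (\<Sum>k\<in>out_nbrs M j. y (j, k)) + v j"
begin

abbreviation "shipper_price \<equiv> SP_shipper_price M d"
abbreviation "carrier_price \<equiv> fluid_carrier_price M y v"

definition fluid_supply :: "'n \<Rightarrow> real" where
  "fluid_supply i = v i + (\<Sum>j\<in>out_nbrs M i. y (i, j))"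

definition supply_gap :: "nat \<Rightarrow> ('n \<Rightarrow> nat) \<Rightarrow> real" where
  "supply_gap \<theta> S = (\<Sum>i\<in>UNIV. \<bar>real (S i) - real \<theta> * fluid_supply i\<bar>)"

text \<open>
  This and \<open>gap_const\<close> collect the factors of \<open>sqrt \<theta>\<close> in the errors of one period. Here the first
  summand bounds the shortage of loads on the lanes of a node, doubled as in \<open>node_deviation\<close>, and the
  second is the constant from there.
\<close>

definition booking_const :: real where
  "booking_const = (\<Sum>i\<in>UNIV. (\<Sum>j\<in>out_nbrs M i. d (i, j) + 1)
     + ((2 * real (card (out_nbrs M i)) + 1) * (1 + (fluid_supply i + 1) / 2) + 1))"

definition max_stay :: real where
  "max_stay = Max (stay_prob M ` lanes M)"

definition gap_const :: real where
  "gap_const = max_stay * booking_const + (\<Sum>e\<in>lanes M. (d e + 1) / 2)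
     + (\<Sum>j\<in>UNIV. (arrival_rate M j + 1) / 2)"

definition margin_const :: real where
  "margin_const = (\<Sum>e\<in>lanes M. \<bar>penalty M e - carrier_price e\<bar>)"

definition fluid_profit :: real where
  "fluid_profit = (\<Sum>e\<in>lanes M. shipper_price e * d e - carrier_price e * y e - penalty M e * (d e - y e))"

lemma max_stay: "0 \<le> max_stay" "max_stay < 1" "e \<in> lanes M \<Longrightarrow> stay_prob M e \<le> max_stay"
proof -
  have "max_stay \<in> stay_prob M ` lanes M"
    unfolding max_stay_def using lanes_nonempty by (intro Max_in) auto
  then show "0 \<le> max_stay" "max_stay < 1" using stay_prob by (auto simp: less_imp_le)
  show "e \<in> lanes M \<Longrightarrow> stay_prob M e \<le> max_stay" unfolding max_stay_def by (intro Max_ge) auto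
qed

lemma fluid_supply_nonneg: "0 \<le> fluid_supply i"
proof -
  have "0 \<le> (\<Sum>j\<in>out_nbrs M i. y (i, j))" using flow by (intro sum_nonneg) (auto simp: out_nbrs_def)
  then show ?thesis unfolding fluid_supply_def using outflow_pos[of i] by simp
qed

lemma fluid_demand_nonneg: "e \<in> lanes M \<Longrightarrow> 0 \<le> d e"
  using flow order_trans by blast

lemma booking_const_nonneg: "0 \<le> booking_const"
  unfolding booking_const_def using fluid_supply_nonneg fluid_demand_nonneg
  by (auto simp: out_nbrs_def intro!: sum_nonneg add_nonneg_nonneg mult_nonneg_nonneg)

lemma gap_const_nonneg: "0 \<le> gap_const"
  unfolding gap_const_def using booking_const_nonneg fluid_demand_nonneg arrival_pos max_stay(1)
  by (auto intro!: sum_nonneg add_nonneg_nonneg mult_nonneg_nonneg simp: less_imp_le)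

lemma supply_gap_nonneg: "0 \<le> supply_gap \<theta> S"
  unfolding supply_gap_def by (intro sum_nonneg) auto

text \<open>
  The fluid carrier price is the one at which the logit weight equals the ratio of booked to leaving
  carriers.
\<close>

lemma fluid_choice_weight:
  assumes "0 < y (i, j)"
  shows "choice_weight (scale \<theta> M) carrier_price i j = y (i, j) / v i"
  using assms sensitivity_pos outflow_pos[of i]
  by (simp add: choice_weight_def fluid_carrier_price_def)

lemma priced_market_scale: "priced_market (scale \<theta> M) shipper_price"
proof
  show "0 \<le> demand (scale \<theta> M) e (shipper_price e)" if "e \<in> lanes (scale \<theta> M)" for e
    using that flow[of e] by (simp add: demand_price)
qed

context
  fixes \<theta> :: nat
  assumes \<theta>: "1 \<le> \<theta>"
begin

abbreviation "loads \<equiv> load_pmf (scale \<theta> M) shipper_price"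
abbreviation "booked S \<equiv> bind_pmf loads (bookings (scale \<theta> M) carrier_price S)"

interpretation priced_market "scale \<theta> M" shipper_price carrier_price
  by (rule priced_market_scale)

lemma load_deviation:
  assumes "e \<in> lanes M"
  shows "mean_le loads (\<lambda>D. \<bar>real (D e) - real \<theta> * d e\<bar>) (sqrt (real \<theta>) * (d e + 1) / 2)"
proof -
  have "mean_le (poisson_dist (real \<theta> * d e)) (\<lambda>k. (real k - real \<theta> * d e)\<^sup>2) (real \<theta> * d e)"
    using flow[OF assms] by (intro poisson_second_moment) auto
  then have "mean_le (poisson_dist (real \<theta> * d e)) (\<lambda>k. \<bar>real k - real \<theta> * d e\<bar>)
      (sqrt (real \<theta>) * (d e + 1) / 2)"
    by (rule mean_le_abs_of_square) (use \<theta> in auto)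
  then have "mean_le (map_pmf (\<lambda>D. D e) loads) (\<lambda>k. \<bar>real k - real \<theta> * d e\<bar>)
      (sqrt (real \<theta>) * (d e + 1) / 2)"
    using assms load_component[of e] by (simp add: demand_price del: mean_le_map)
  then show ?thesis by simp
qed

text \<open>
  A lane with loads has positive fluid flow, so that its logit weight is the fluid ratio.
\<close>

lemma load_support:
  assumes "D \<in> set_pmf loads" "e \<in> lanes M" "0 < D e"
  shows "0 < y e"
proof -
  have "D e \<in> set_pmf (map_pmf (\<lambda>D. D e) loads)" using assms(1) by auto
  then have "D e \<in> set_pmf (poisson_dist (real \<theta> * d e))"
    using assms(2) load_component[of e] by (simp add: demand_price del: set_map_pmf)
  then have "d e \<noteq> 0" using assms(3) by (auto simp: poisson_dist_def)
  then show ?thesis using flow[OF assms(2)] flow_pos[OF assms(2)] by simp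
qed

lemma booking_deviation:
  "mean_le (booked S) (\<lambda>Y. \<Sum>e\<in>lanes M. \<bar>real (Y e) - real \<theta> * y e\<bar>)
     (supply_gap \<theta> S + booking_const * sqrt (real \<theta>))"
proof (rule mean_le_bind)
  let ?B = "\<lambda>i. (2 * real (card (out_nbrs M i)) + 1) * (1 + (fluid_supply i + 1) / 2) + 1"
  let ?g = "\<lambda>D i. \<bar>real (S i) - real \<theta> * fluid_supply i\<bar>
    + (\<Sum>j\<in>out_nbrs M i. 2 * max 0 (real \<theta> * d (i, j) - real (D (i, j)))) + ?B i * sqrt (real \<theta>)"
  show "mean_le (bookings (scale \<theta> M) carrier_price S D)
      (\<lambda>Y. \<Sum>e\<in>lanes M. \<bar>real (Y e) - real \<theta> * y e\<bar>) (\<Sum>i\<in>UNIV. ?g D i)"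
    if D: "D \<in> set_pmf loads" for D
  proof -
    have "mean_le (map_pmf (\<lambda>Y j. Y (i, j)) (bookings (scale \<theta> M) carrier_price S D))
        (\<lambda>Y. \<Sum>j\<in>out_nbrs M i. \<bar>real (Y j) - real \<theta> * y (i, j)\<bar>) (?g D i)" for i
      unfolding bookings_node fluid_supply_def
      by (rule node_deviation[where d = "\<lambda>j. d (i, j)" and v = "v i" and M = "scale \<theta> M", simplified])
         (use outflow_pos[of i] \<theta> flow load_support[OF D] in
           \<open>auto simp: out_nbrs_def intro!: fluid_choice_weight\<close>)
    then have "mean_le (bookings (scale \<theta> M) carrier_price S D)
        (\<lambda>Y. \<Sum>j\<in>out_nbrs M i. \<bar>real (Y (i, j)) - real \<theta> * y (i, j)\<bar>) (?g D i)" for i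
      by simp
    then have "mean_le (bookings (scale \<theta> M) carrier_price S D)
        (\<lambda>Y. \<Sum>i\<in>UNIV. \<Sum>j\<in>out_nbrs M i. \<bar>real (Y (i, j)) - real \<theta> * y (i, j)\<bar>) (\<Sum>i\<in>UNIV. ?g D i)"
      by (intro mean_le_sum) auto
    then show ?thesis
      by (simp only: sum_over_tails[where f = "\<lambda>e. \<bar>real (Y e) - real \<theta> * y e\<bar>" for Y])
  qed
  have lane: "mean_le loads (\<lambda>D. 2 * max 0 (real \<theta> * d (i, j) - real (D (i, j))))
      ((d (i, j) + 1) * sqrt (real \<theta>))" if "j \<in> out_nbrs M i" for i j
  proof -
    have "mean_le loads (\<lambda>D. 2 * \<bar>real (D (i, j)) - real \<theta> * d (i, j)\<bar>)
        (2 * (sqrt (real \<theta>) * (d (i, j) + 1) / 2))"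
      using that by (intro mean_le_cmult load_deviation) (auto simp: out_nbrs_def)
    then show ?thesis by (rule mean_le_mono) (auto simp: mult.commute)
  qed
  have nonneg: "0 \<le> ?B i * sqrt (real \<theta>)" for i
    using fluid_supply_nonneg[of i] by simp
  have "mean_le loads (\<lambda>D. \<Sum>i\<in>UNIV. ?g D i) (\<Sum>i\<in>UNIV. \<bar>real (S i) - real \<theta> * fluid_supply i\<bar>
      + (\<Sum>j\<in>out_nbrs M i. (d (i, j) + 1) * sqrt (real \<theta>)) + ?B i * sqrt (real \<theta>))"
    by (intro mean_le_sum mean_le_add lane) (auto intro: mean_le_const nonneg)
  also have "(\<Sum>i\<in>UNIV. \<bar>real (S i) - real \<theta> * fluid_supply i\<bar>
      + (\<Sum>j\<in>out_nbrs M i. (d (i, j) + 1) * sqrt (real \<theta>)) + ?B i * sqrt (real \<theta>))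
      = supply_gap \<theta> S + booking_const * sqrt (real \<theta>)"
    by (simp only: supply_gap_def booking_const_def sum.distrib sum_distrib_right distrib_right add.assoc)
  finally show "mean_le loads (\<lambda>D. \<Sum>i\<in>UNIV. ?g D i) (supply_gap \<theta> S + booking_const * sqrt (real \<theta>))" .
qed

text \<open>
  By flow balance the fluid supply of node \<open>j\<close> is the sum of its fluid inflows and arrivals. So the gap
  at \<open>j\<close> splits into the booking deviations on incoming lanes, thinned by the staying probabilities, and
  the fluctuations of the binomial and Poisson variables.
\<close>

lemma arrivals_deviation:
  "mean_le (arrivals_after (scale \<theta> M) Y) (supply_gap \<theta>)
     (max_stay * (\<Sum>e\<in>lanes M. \<bar>real (Y e) - real \<theta> * y e\<bar>)
      + (\<Sum>e\<in>lanes M. sqrt (real \<theta>) * (real (Y e) / real \<theta> + 1) / 2)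
      + (\<Sum>j\<in>UNIV. sqrt (real \<theta>) * (arrival_rate M j + 1) / 2))"
proof -
  let ?a = "max_stay * (\<Sum>e\<in>lanes M. \<bar>real (Y e) - real \<theta> * y e\<bar>)"
  let ?c = "\<Sum>j\<in>UNIV. sqrt (real \<theta>) * (arrival_rate M j + 1) / 2"
  let ?z = "\<lambda>Z. \<Sum>e\<in>lanes M. \<bar>real (Z e) - stay_prob M e * real (Y e)\<bar>"
  have a: "0 \<le> ?a" using max_stay(1) by (intro mult_nonneg_nonneg sum_nonneg) auto
  have Z: "mean_le (Pi_pmf (lanes M) 0 (\<lambda>e. binomial_pmf (Y e) (stay_prob M e))) ?z
      (\<Sum>e\<in>lanes M. sqrt (real \<theta>) * (real (Y e) / real \<theta> + 1) / 2)"
  proof (intro mean_le_sum mean_le_Pi_pmf)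
    fix e assume e: "e \<in> lanes M"
    show "mean_le (binomial_pmf (Y e) (stay_prob M e)) (\<lambda>z. \<bar>real z - stay_prob M e * real (Y e)\<bar>)
       (sqrt (real \<theta>) * (real (Y e) / real \<theta> + 1) / 2)"
      by (rule mean_le_abs_of_square, rule mean_le_mono[OF binomial_second_moment])
         (use stay_prob[OF e] \<theta> in auto)
  qed auto
  have L: "mean_le (Pi_pmf UNIV 0 (\<lambda>j. poisson_dist (real \<theta> * arrival_rate M j)))
      (\<lambda>L. \<Sum>j\<in>UNIV. \<bar>real (L j) - real \<theta> * arrival_rate M j\<bar>) ?c"
  proof (intro mean_le_sum mean_le_Pi_pmf)
    fix j
    show "mean_le (poisson_dist (real \<theta> * arrival_rate M j))
        (\<lambda>l. \<bar>real l - real \<theta> * arrival_rate M j\<bar>) (sqrt (real \<theta>) * (arrival_rate M j + 1) / 2)"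
      by (rule mean_le_abs_of_square, rule poisson_second_moment)
         (use arrival_pos[of j] \<theta> in \<open>auto simp: less_imp_le\<close>)
  qed auto
  have "supply_gap \<theta> (\<lambda>j. (\<Sum>i\<in>in_nbrs M j. Z (i, j)) + L j)
      \<le> (?a + ?z Z) + (\<Sum>j\<in>UNIV. \<bar>real (L j) - real \<theta> * arrival_rate M j\<bar>)" for Z L
  proof -
    have "\<bar>real ((\<Sum>i\<in>in_nbrs M j. Z (i, j)) + L j) - real \<theta> * fluid_supply j\<bar>
        \<le> (\<Sum>i\<in>in_nbrs M j. max_stay * \<bar>real (Y (i, j)) - real \<theta> * y (i, j)\<bar>
             + \<bar>real (Z (i, j)) - stay_prob M (i, j) * real (Y (i, j))\<bar>)
          + \<bar>real (L j) - real \<theta> * arrival_rate M j\<bar>" for j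
    proof -
      have "real ((\<Sum>i\<in>in_nbrs M j. Z (i, j)) + L j) - real \<theta> * fluid_supply j
          = (\<Sum>i\<in>in_nbrs M j. real (Z (i, j)) - real \<theta> * (stay_prob M (i, j) * y (i, j)))
            + (real (L j) - real \<theta> * arrival_rate M j)"
      proof -
        have "fluid_supply j = (\<Sum>i\<in>in_nbrs M j. stay_prob M (i, j) * y (i, j)) + arrival_rate M j"
          using balance[of j] by (simp add: fluid_supply_def)
        then show ?thesis by (simp add: sum_subtractf sum_distrib_left distrib_left)
      qed
      also have "\<bar>\<dots>\<bar> \<le> \<bar>\<Sum>i\<in>in_nbrs M j. real (Z (i, j)) - real \<theta> * (stay_prob M (i, j) * y (i, j))\<bar>
            + \<bar>real (L j) - real \<theta> * arrival_rate M j\<bar>"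
        by (rule abs_triangle_ineq)
      also have "\<bar>\<Sum>i\<in>in_nbrs M j. real (Z (i, j)) - real \<theta> * (stay_prob M (i, j) * y (i, j))\<bar>
          \<le> (\<Sum>i\<in>in_nbrs M j. max_stay * \<bar>real (Y (i, j)) - real \<theta> * y (i, j)\<bar>
             + \<bar>real (Z (i, j)) - stay_prob M (i, j) * real (Y (i, j))\<bar>)"
      proof (rule order_trans[OF sum_abs], rule sum_mono)
        fix i assume "i \<in> in_nbrs M j"
        then have e: "(i, j) \<in> lanes M" by (simp add: in_nbrs_def)
        let ?q = "stay_prob M (i, j)"
        have "real (Z (i, j)) - real \<theta> * (?q * y (i, j))
          = ?q * (real (Y (i, j)) - real \<theta> * y (i, j)) + (real (Z (i, j)) - ?q * real (Y (i, j)))"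
          by (simp add: algebra_simps)
        also have "\<bar>\<dots>\<bar> \<le> \<bar>?q * (real (Y (i, j)) - real \<theta> * y (i, j))\<bar>
            + \<bar>real (Z (i, j)) - ?q * real (Y (i, j))\<bar>"
          by (rule abs_triangle_ineq)
        also have "\<bar>?q * (real (Y (i, j)) - real \<theta> * y (i, j))\<bar>
            \<le> max_stay * \<bar>real (Y (i, j)) - real \<theta> * y (i, j)\<bar>"
          unfolding abs_mult using stay_prob[OF e] max_stay(3)[OF e] by (intro mult_right_mono) auto
        finally show "\<bar>real (Z (i, j)) - real \<theta> * (?q * y (i, j))\<bar>
          \<le> max_stay * \<bar>real (Y (i, j)) - real \<theta> * y (i, j)\<bar> + \<bar>real (Z (i, j)) - ?q * real (Y (i, j))\<bar>"
          by simp
      qed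
      finally show ?thesis by simp
    qed
    then have "supply_gap \<theta> (\<lambda>j. (\<Sum>i\<in>in_nbrs M j. Z (i, j)) + L j)
        \<le> (\<Sum>j\<in>UNIV. (\<Sum>i\<in>in_nbrs M j. max_stay * \<bar>real (Y (i, j)) - real \<theta> * y (i, j)\<bar>
             + \<bar>real (Z (i, j)) - stay_prob M (i, j) * real (Y (i, j))\<bar>)
          + \<bar>real (L j) - real \<theta> * arrival_rate M j\<bar>)"
      unfolding supply_gap_def by (intro sum_mono)
    also have "\<dots> = (?a + ?z Z) + (\<Sum>j\<in>UNIV. \<bar>real (L j) - real \<theta> * arrival_rate M j\<bar>)"
      unfolding sum.distrib[of _ _ UNIV]
        sum_over_heads[where f = "\<lambda>e. max_stay * \<bar>real (Y e) - real \<theta> * y e\<bar>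
             + \<bar>real (Z e) - stay_prob M e * real (Y e)\<bar>"]
      by (simp add: sum.distrib sum_distrib_left)
    finally show ?thesis .
  qed
  note pointwise = this
  have arrive: "mean_le (map_pmf (\<lambda>L j. (\<Sum>i\<in>in_nbrs M j. Z (i, j)) + L j)
      (Pi_pmf UNIV 0 (\<lambda>j. poisson_dist (real \<theta> * arrival_rate M j)))) (supply_gap \<theta>)
      ((?a + ?z Z) + ?c)" for Z
    unfolding mean_le_map
    by (rule mean_le_mono[OF mean_le_add[OF mean_le_const[of _ "\<lambda>_. ?a + ?z Z", OF order_refl] L] pointwise])
       (use a in \<open>auto intro!: add_nonneg_nonneg sum_nonneg\<close>)
  have "mean_le (Pi_pmf (lanes M) 0 (\<lambda>e. binomial_pmf (Y e) (stay_prob M e)))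
      (\<lambda>Z. (?a + ?z Z) + ?c)
      ((?a + (\<Sum>e\<in>lanes M. sqrt (real \<theta>) * (real (Y e) / real \<theta> + 1) / 2)) + ?c)"
    by (intro mean_le_add Z mean_le_const order_refl a mean_leD[OF L])
  from mean_le_bind[OF arrive this] show ?thesis
    by (simp only: arrivals_after_def scale_simps)
qed

lemma booked_mean:
  assumes "e \<in> lanes M"
  shows "mean_le (booked S) (\<lambda>Y. real (Y e)) (real \<theta> * d e)"
proof (rule mean_le_bind)
  show "mean_le loads (\<lambda>D. real (D e)) (real \<theta> * d e)"
    using load_expectation[of e] assms by (intro mean_leI) (auto simp: demand_price)
qed (auto intro!: mean_le_const simp: bookings_support)

text \<open>
  Summing the node bounds reproduces the supply gap with factor one, and thinning multiplies it by
  \<open>max_stay\<close>.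
\<close>

lemma supply_gap_contraction:
  "mean_le (supply_step (scale \<theta> M) shipper_price carrier_price S) (supply_gap \<theta>)
     (max_stay * supply_gap \<theta> S + gap_const * sqrt (real \<theta>))"
proof -
  have step: "supply_step (scale \<theta> M) shipper_price carrier_price S
      = bind_pmf (booked S) (arrivals_after (scale \<theta> M))"
    by (simp add: supply_step_def next_supply_def[abs_def] bind_assoc_pmf)
  have lane: "mean_le (booked S) (\<lambda>Y. sqrt (real \<theta>) * (real (Y e) / real \<theta> + 1) / 2)
      ((d e + 1) / 2 * sqrt (real \<theta>))" if "e \<in> lanes M" for e
  proof -
    have "mean_le (booked S) (\<lambda>Y. sqrt (real \<theta>) / (2 * real \<theta>) * real (Y e) + sqrt (real \<theta>) / 2)
      (sqrt (real \<theta>) / (2 * real \<theta>) * (real \<theta> * d e) + sqrt (real \<theta>) / 2)"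
      by (intro mean_le_add mean_le_cmult booked_mean[OF that]) (auto intro: mean_le_const)
    then show ?thesis
      by (rule mean_le_mono) (use \<theta> in \<open>auto simp: field_simps\<close>)
  qed
  have rate: "0 \<le> (\<Sum>j\<in>UNIV. sqrt (real \<theta>) * (arrival_rate M j + 1) / 2)"
    using arrival_pos by (intro sum_nonneg) (simp add: less_imp_le add_nonneg_nonneg)
  have "mean_le (supply_step (scale \<theta> M) shipper_price carrier_price S) (supply_gap \<theta>)
     (max_stay * (supply_gap \<theta> S + booking_const * sqrt (real \<theta>))
      + (\<Sum>e\<in>lanes M. (d e + 1) / 2 * sqrt (real \<theta>))
      + (\<Sum>j\<in>UNIV. sqrt (real \<theta>) * (arrival_rate M j + 1) / 2))"
    unfolding step
    by (rule mean_le_bind[OF arrivals_deviation],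
        intro mean_le_add mean_le_cmult booking_deviation mean_le_sum lane mean_le_const order_refl
          rate max_stay(1))
  also have "(\<Sum>e\<in>lanes M. (d e + 1) / 2 * sqrt (real \<theta>)) = (\<Sum>e\<in>lanes M. (d e + 1) / 2) * sqrt (real \<theta>)"
    by (simp only: sum_distrib_right)
  also have "(\<Sum>j\<in>UNIV. sqrt (real \<theta>) * (arrival_rate M j + 1) / 2)
      = (\<Sum>j\<in>UNIV. (arrival_rate M j + 1) / 2) * sqrt (real \<theta>)"
    unfolding sum_distrib_right by (intro sum.cong) auto
  also have "max_stay * (supply_gap \<theta> S + booking_const * sqrt (real \<theta>))
        + (\<Sum>e\<in>lanes M. (d e + 1) / 2) * sqrt (real \<theta>)
        + (\<Sum>j\<in>UNIV. (arrival_rate M j + 1) / 2) * sqrt (real \<theta>)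
      = max_stay * supply_gap \<theta> S + gap_const * sqrt (real \<theta>)"
    by (simp only: gap_const_def distrib_left distrib_right mult.assoc add.assoc)
  finally show ?thesis .
qed

text \<open>
  Since the long-run average does not depend on the start, a marketplace without carriers will do.
\<close>

definition "supply_path t = ((\<lambda>\<rho>. bind_pmf \<rho> (supply_step (scale \<theta> M) shipper_price carrier_price)) ^^ t)
  (return_pmf (\<lambda>_. 0))"

lemma supply_gap_path:
  "mean_le (supply_path t) (supply_gap \<theta>)
     (max_stay ^ t * supply_gap \<theta> (\<lambda>_. 0) + gap_const / (1 - max_stay) * sqrt (real \<theta>))"
proof (induction t)
  case 0
  have "0 \<le> gap_const / (1 - max_stay) * sqrt (real \<theta>)"
    using max_stay gap_const_nonneg by simp
  then show ?case using supply_gap_nonneg[of \<theta> "\<lambda>_. 0"] by (simp add: supply_path_def)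
next
  case (Suc t)
  let ?g = "gap_const / (1 - max_stay) * sqrt (real \<theta>)"
  have "supply_path (Suc t) = bind_pmf (supply_path t) (supply_step (scale \<theta> M) shipper_price carrier_price)"
    by (simp add: supply_path_def)
  moreover have "mean_le (supply_path t) (\<lambda>S. max_stay * supply_gap \<theta> S + gap_const * sqrt (real \<theta>))
      (max_stay * (max_stay ^ t * supply_gap \<theta> (\<lambda>_. 0) + ?g) + gap_const * sqrt (real \<theta>))"
    using max_stay(1) gap_const_nonneg by (intro mean_le_add mean_le_cmult Suc mean_le_const) auto
  moreover have "max_stay * (x + ?g) + gap_const * sqrt (real \<theta>) = max_stay * x + ?g" for x
    using max_stay by (simp add: field_simps)
  ultimately show ?case
    using mean_le_bind[OF supply_gap_contraction] by (simp add: mult.assoc)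
qed

lemma mean_served_deviation:
  assumes e: "e \<in> lanes M"
  shows "\<bar>mean_served (scale \<theta> M) shipper_price carrier_price S e - real \<theta> * y e\<bar>
    \<le> supply_gap \<theta> S + booking_const * sqrt (real \<theta>)"
proof -
  have int: "integrable (measure_pmf (booked S)) (\<lambda>Y. real (Y e))"
    using booked_mean[OF e] by (rule mean_le_expectation) auto
  have "mean_le (booked S) (\<lambda>Y. \<bar>real (Y e) - real \<theta> * y e\<bar>)
      (supply_gap \<theta> S + booking_const * sqrt (real \<theta>))"
  proof (rule mean_le_mono[OF booking_deviation])
    show "\<bar>real (Y e) - real \<theta> * y e\<bar> \<le> (\<Sum>e\<in>lanes M. \<bar>real (Y e) - real \<theta> * y e\<bar>)" for Y
      using e by (intro member_le_sum[of e "lanes M" "\<lambda>e. \<bar>real (Y e) - real \<theta> * y e\<bar>"]) auto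
  qed simp
  then have "measure_pmf.expectation (booked S) (\<lambda>Y. \<bar>real (Y e) - real \<theta> * y e\<bar>)
      \<le> supply_gap \<theta> S + booking_const * sqrt (real \<theta>)"
    by (rule mean_le_expectation) auto
  moreover have "mean_served (scale \<theta> M) shipper_price carrier_price S e
      = measure_pmf.expectation (booked S) (\<lambda>Y. real (Y e))"
    unfolding mean_served_def served_def[abs_def] using int by (subst expectation_bind) auto
  moreover have "measure_pmf.expectation (booked S) (\<lambda>Y. real (Y e)) - real \<theta> * y e
      = measure_pmf.expectation (booked S) (\<lambda>Y. real (Y e) - real \<theta> * y e)"
    using int by simp
  moreover have "\<bar>measure_pmf.expectation (booked S) (\<lambda>Y. real (Y e) - real \<theta> * y e)\<bar>
      \<le> measure_pmf.expectation (booked S) (\<lambda>Y. \<bar>real (Y e) - real \<theta> * y e\<bar>)"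
    by (rule integral_abs_bound)
  ultimately show ?thesis by linarith
qed

text \<open>
  Replacing mean bookings by their fluid values turns the profit into \<open>\<theta> * fluid_profit\<close>; the error on
  each lane is weighted by the margin \<open>penalty - price\<close>. Its sign is not determined, which is why
  bookings are estimated from both sides.
\<close>

lemma supply_profit_deviation:
  "\<bar>supply_profit (scale \<theta> M) shipper_price carrier_price S - real \<theta> * fluid_profit\<bar>
    \<le> margin_const * (supply_gap \<theta> S + booking_const * sqrt (real \<theta>))"
proof -
  let ?m = "mean_served (scale \<theta> M) shipper_price carrier_price S"
  have "supply_profit (scale \<theta> M) shipper_price carrier_price S
      = (\<Sum>e\<in>lanes M. real \<theta> * ((shipper_price e - penalty M e) * d e) + (penalty M e - carrier_price e) * ?m e)"
    unfolding supply_profit_def by (intro sum.cong) (auto simp: demand_price)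
  moreover have "real \<theta> * fluid_profit = (\<Sum>e\<in>lanes M. real \<theta> * ((shipper_price e - penalty M e) * d e)
      + (penalty M e - carrier_price e) * (real \<theta> * y e))"
    unfolding fluid_profit_def sum_distrib_left by (intro sum.cong) (auto simp: algebra_simps)
  ultimately have "supply_profit (scale \<theta> M) shipper_price carrier_price S - real \<theta> * fluid_profit
      = (\<Sum>e\<in>lanes M. (penalty M e - carrier_price e) * (?m e - real \<theta> * y e))"
    by (simp add: sum_subtractf[symmetric] right_diff_distrib)
  also have "\<bar>\<dots>\<bar> \<le> (\<Sum>e\<in>lanes M. \<bar>penalty M e - carrier_price e\<bar>
      * (supply_gap \<theta> S + booking_const * sqrt (real \<theta>)))"
    by (rule order_trans[OF sum_abs], rule sum_mono, unfold abs_mult)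
       (intro mult_left_mono mean_served_deviation, auto)
  finally show ?thesis by (simp only: margin_const_def sum_distrib_right)
qed

lemma long_run_profit_deviation:
  "\<bar>gamma_SP M d y v \<theta> - real \<theta> * fluid_profit\<bar>
    \<le> margin_const * (gap_const / (1 - max_stay) + booking_const) * sqrt (real \<theta>)"
proof -
  let ?f = "supply_profit (scale \<theta> M) shipper_price carrier_price"
  let ?K = "gap_const / (1 - max_stay) + booking_const"
  have margin: "0 \<le> margin_const" unfolding margin_const_def by (intro sum_nonneg) auto
  obtain B where B: "\<And>S. \<bar>?f S\<bar> \<le> B" using supply_profit_bounded by blast
  have bound: "\<bar>measure_pmf.expectation (supply_path t) ?f - real \<theta> * fluid_profit\<bar>
      \<le> margin_const * (max_stay ^ t * supply_gap \<theta> (\<lambda>_. 0) + ?K * sqrt (real \<theta>))" for t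
  proof -
    have int: "integrable (measure_pmf (supply_path t)) ?f" by (rule integrable_bounded_pmf[OF B])
    have "mean_le (supply_path t) (\<lambda>S. \<bar>?f S - real \<theta> * fluid_profit\<bar>)
      (margin_const * ((max_stay ^ t * supply_gap \<theta> (\<lambda>_. 0) + gap_const / (1 - max_stay) * sqrt (real \<theta>))
        + booking_const * sqrt (real \<theta>)))"
      by (rule mean_le_mono[OF mean_le_cmult[OF mean_le_add[OF supply_gap_path
              mean_le_const[of _ "\<lambda>_. booking_const * sqrt (real \<theta>)", OF order_refl]]] supply_profit_deviation])
         (use margin booking_const_nonneg in auto)
    then have "measure_pmf.expectation (supply_path t) (\<lambda>S. \<bar>?f S - real \<theta> * fluid_profit\<bar>)
      \<le> (margin_const * ((max_stay ^ t * supply_gap \<theta> (\<lambda>_. 0) + gap_const / (1 - max_stay) * sqrt (real \<theta>))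
        + booking_const * sqrt (real \<theta>)))"
      by (rule mean_le_expectation) auto
    moreover have "\<bar>measure_pmf.expectation (supply_path t) (\<lambda>S. ?f S - real \<theta> * fluid_profit)\<bar>
      \<le> measure_pmf.expectation (supply_path t) (\<lambda>S. \<bar>?f S - real \<theta> * fluid_profit\<bar>)"
      by (rule integral_abs_bound)
    moreover have "measure_pmf.expectation (supply_path t) (\<lambda>S. ?f S - real \<theta> * fluid_profit)
        = measure_pmf.expectation (supply_path t) ?f - real \<theta> * fluid_profit"
      using int by simp
    ultimately show ?thesis by (simp only: distrib_right add.assoc)
  qed
  have "(\<lambda>t. margin_const * (max_stay ^ t * supply_gap \<theta> (\<lambda>_. 0) + ?K * sqrt (real \<theta>)))
      \<longlonglongrightarrow> margin_const * (0 * supply_gap \<theta> (\<lambda>_. 0) + ?K * sqrt (real \<theta>))"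
    using max_stay by (intro tendsto_intros LIMSEQ_power_zero) auto
  moreover have "(\<lambda>t. \<bar>measure_pmf.expectation (supply_path t) ?f - real \<theta> * fluid_profit\<bar>)
      \<longlonglongrightarrow> \<bar>gamma_SP M d y v \<theta> - real \<theta> * fluid_profit\<bar>"
    unfolding gamma_SP_def supply_path_def by (intro tendsto_intros long_run_profit_limit)
  ultimately have "\<bar>gamma_SP M d y v \<theta> - real \<theta> * fluid_profit\<bar>
      \<le> margin_const * (0 * supply_gap \<theta> (\<lambda>_. 0) + ?K * sqrt (real \<theta>))"
    using bound by (intro LIMSEQ_le[OF _ _ exI]) auto
  then show ?thesis by (simp add: mult.assoc)
qed

lemma SP_average_profit_limit: "SP_average_profit M d y v \<theta> x \<longlonglongrightarrow> gamma_SP M d y v \<theta>"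
  unfolding SP_average_profit_def[abs_def] gamma_SP_def by (rule long_run_profit_limit)

end

end

section \<open>Optimal solutions of the fluid problem\<close>

lemma fluid_objective_infinite:
  fixes M :: "'n::finite market"
  assumes "(i, j) \<in> lanes M" "v i = 0" "0 < y (i, j)"
  shows "fluid_objective M d y v = - \<infinity>"
proof -
  let ?t = "\<lambda>(i, j). if v i = 0 \<and> 0 < y (i, j) then - \<infinity>
     else ereal (inverse_demand M (i, j) (d (i, j)) * d (i, j)
            - fluid_carrier_price M y v (i, j) * y (i, j)
            - penalty M (i, j) * (d (i, j) - y (i, j)))"
  have "(\<Sum>e\<in>lanes M - {(i, j)}. ?t e) \<noteq> \<infinity>" by (auto simp: sum_Pinfty split: if_splits)
  moreover have "fluid_objective M d y v = ?t (i, j) + (\<Sum>e\<in>lanes M - {(i, j)}. ?t e)"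
    unfolding fluid_objective_def using assms(1) by (intro sum.remove) auto
  ultimately show ?thesis using assms by simp
qed

definition lane_profit ::
  "'n market \<Rightarrow> ('n \<times> 'n \<Rightarrow> real) \<Rightarrow> ('n \<times> 'n \<Rightarrow> real) \<Rightarrow> ('n \<Rightarrow> real) \<Rightarrow> 'n \<times> 'n \<Rightarrow> real" where
  "lane_profit M d y v e = inverse_demand M e (d e) * d e
     - fluid_carrier_price M y v e * y e - penalty M e * (d e - y e)"

lemma fluid_objective_finite:
  fixes M :: "'n::finite market"
  assumes "\<And>i j. (i, j) \<in> lanes M \<Longrightarrow> \<not> (v i = 0 \<and> 0 < y (i, j))"
  shows "fluid_objective M d y v = ereal (sum (lane_profit M d y v) (lanes M))"
proof -
  have "fluid_objective M d y v = (\<Sum>e\<in>lanes M. ereal (lane_profit M d y v e))"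
    unfolding fluid_objective_def by (intro sum.cong) (use assms in \<open>auto simp: lane_profit_def\<close>)
  then show ?thesis by simp
qed

lemma gamma_FA_eq:
  assumes "fluid_optimal M d y v"
  shows "gamma_FA M = real_of_ereal (fluid_objective M d y v)"
proof -
  have "(SUP (d, y, v)\<in>{(d, y, v). fluid_feasible M d y v}. fluid_objective M d y v)
      = fluid_objective M d y v"
    using assms unfolding fluid_optimal_def
    by (intro antisym SUP_least SUP_upper2[of "(d, y, v)"]) auto
  then show ?thesis by (simp add: gamma_FA_def)
qed

lemma inverse_demand_scale:
  assumes "1 \<le> \<theta>"
  shows "inverse_demand (scale \<theta> M) e (real \<theta> * x) = inverse_demand M e x"
  using assms by (simp add: inverse_demand_def the_inv_into_def)

lemma demand_range_scale:
  assumes "1 \<le> \<theta>"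
  shows "real \<theta> * x \<in> demand_range (scale \<theta> M) e \<longleftrightarrow> x \<in> demand_range M e"
  using assms by (auto simp: demand_range_def image_iff)

lemma fluid_feasible_scale:
  fixes M :: "'n::finite market"
  assumes "1 \<le> \<theta>"
  shows "fluid_feasible (scale \<theta> M) (\<lambda>e. real \<theta> * d e) (\<lambda>e. real \<theta> * y e) (\<lambda>i. real \<theta> * v i)
    \<longleftrightarrow> fluid_feasible M d y v"
proof -
  have "(\<Sum>i\<in>in_nbrs M j. stay_prob M (i, j) * (real \<theta> * y (i, j))) + real \<theta> * arrival_rate M j
      = (\<Sum>k\<in>out_nbrs M j. real \<theta> * y (j, k)) + real \<theta> * v j
    \<longleftrightarrow> real \<theta> * ((\<Sum>i\<in>in_nbrs M j. stay_prob M (i, j) * y (i, j)) + arrival_rate M j)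
      = real \<theta> * ((\<Sum>k\<in>out_nbrs M j. y (j, k)) + v j)" for j
    by (simp add: sum_distrib_left distrib_left mult.left_commute)
  with assms show ?thesis
    unfolding fluid_feasible_def by (simp add: demand_range_scale zero_le_mult_iff)
qed

lemma lane_profit_scale:
  assumes "1 \<le> \<theta>"
  shows "lane_profit (scale \<theta> M) (\<lambda>e. real \<theta> * d e) (\<lambda>e. real \<theta> * y e) (\<lambda>i. real \<theta> * v i) e
    = real \<theta> * lane_profit M d y v e"
proof -
  have "fluid_carrier_price (scale \<theta> M) (\<lambda>e. real \<theta> * y e) (\<lambda>i. real \<theta> * v i) e = fluid_carrier_price M y v e"
    using assms by (auto simp: fluid_carrier_price_def split: prod.split)
  then show ?thesis
    using assms by (simp add: lane_profit_def inverse_demand_scale right_diff_distrib mult_ac)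
qed

text \<open>
  Prices depend on flows only through ratios and on demand only relative to its scale.
\<close>

lemma fluid_objective_scale:
  fixes M :: "'n::finite market"
  assumes "1 \<le> \<theta>"
  shows "fluid_objective (scale \<theta> M) (\<lambda>e. real \<theta> * d e) (\<lambda>e. real \<theta> * y e) (\<lambda>i. real \<theta> * v i)
    = ereal (real \<theta>) * fluid_objective M d y v"
proof (cases "\<exists>i j. (i, j) \<in> lanes M \<and> v i = 0 \<and> 0 < y (i, j)")
  case True
  then obtain i j where ij: "(i, j) \<in> lanes M" "v i = 0" "0 < y (i, j)" by blast
  have "fluid_objective (scale \<theta> M) (\<lambda>e. real \<theta> * d e) (\<lambda>e. real \<theta> * y e) (\<lambda>i. real \<theta> * v i) = - \<infinity>"
    using ij assms by (intro fluid_objective_infinite[of i j]) auto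
  then show ?thesis
    using assms by (simp add: fluid_objective_infinite[of i j M v y d, OF ij])
next
  case False
  then show ?thesis
    using assms
    by (subst (1 2) fluid_objective_finite)
       (auto simp: lane_profit_scale sum_distrib_left zero_less_mult_iff)
qed

lemma gamma_FA_scale:
  fixes M :: "'n::finite market"
  assumes "fluid_optimal M d y v" "1 \<le> \<theta>"
  shows "gamma_FA (scale \<theta> M) = real \<theta> * gamma_FA M"
proof -
  have "fluid_optimal (scale \<theta> M) (\<lambda>e. real \<theta> * d e) (\<lambda>e. real \<theta> * y e) (\<lambda>i. real \<theta> * v i)"
    unfolding fluid_optimal_def
  proof (intro conjI allI impI)
    show "fluid_feasible (scale \<theta> M) (\<lambda>e. real \<theta> * d e) (\<lambda>e. real \<theta> * y e) (\<lambda>i. real \<theta> * v i)"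
      using assms by (simp add: fluid_feasible_scale fluid_optimal_def)
    fix d' y' v' assume feas: "fluid_feasible (scale \<theta> M) d' y' v'"
    define d1 y1 v1 where "d1 e = d' e / real \<theta>" and "y1 e = y' e / real \<theta>" and "v1 i = v' i / real \<theta>" for e i
    have eq: "d' = (\<lambda>e. real \<theta> * d1 e)" "y' = (\<lambda>e. real \<theta> * y1 e)" "v' = (\<lambda>i. real \<theta> * v1 i)"
      using assms(2) by (auto simp: d1_def y1_def v1_def)
    have "fluid_objective M d1 y1 v1 \<le> fluid_objective M d y v"
      using assms feas unfolding eq by (simp add: fluid_feasible_scale fluid_optimal_def)
    then show "fluid_objective (scale \<theta> M) d' y' v'
      \<le> fluid_objective (scale \<theta> M) (\<lambda>e. real \<theta> * d e) (\<lambda>e. real \<theta> * y e) (\<lambda>i. real \<theta> * v i)"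
      unfolding eq fluid_objective_scale[OF assms(2)] by (intro ereal_mult_left_mono) auto
  qed
  then show ?thesis
    using assms by (simp add: gamma_FA_eq fluid_objective_scale)
qed

text \<open>
  If \<open>v i = 0\<close>, balance sends the positive arrivals of \<open>i\<close> onto some outgoing lane, at cost \<open>\<infinity>\<close>; but
  a positive \<open>gamma_FA\<close> is the value of a finite objective, as \<open>real_of_ereal\<close> maps infinite values to zero.
\<close>

lemma optimal_outflow_pos:
  fixes M :: "'n::finite market"
  assumes "freight_market M" "fluid_optimal M d y v" "0 < gamma_FA M"
  shows "0 < v i"
proof (rule ccontr)
  assume "\<not> 0 < v i"
  moreover have feas: "fluid_feasible M d y v" using assms(2) by (simp add: fluid_optimal_def)
  ultimately have v: "v i = 0" by (simp add: fluid_feasible_def order.antisym not_less)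
  have "0 \<le> (\<Sum>k\<in>in_nbrs M i. stay_prob M (k, i) * y (k, i))"
    using feas assms(1)
    by (intro sum_nonneg mult_nonneg_nonneg)
       (auto simp: fluid_feasible_def freight_market_def in_nbrs_def less_imp_le)
  moreover have "0 < arrival_rate M i" using assms(1) by (simp add: freight_market_def)
  moreover have "(\<Sum>k\<in>in_nbrs M i. stay_prob M (k, i) * y (k, i)) + arrival_rate M i
      = (\<Sum>k\<in>out_nbrs M i. y (i, k)) + v i"
    using feas by (simp add: fluid_feasible_def)
  ultimately have "0 < (\<Sum>k\<in>out_nbrs M i. y (i, k))" using v by linarith
  then obtain j where j: "j \<in> out_nbrs M i" "0 < y (i, j)"
    by (meson not_less sum_nonpos)
  then have "fluid_objective M d y v = - \<infinity>"
    using v by (intro fluid_objective_infinite[of i j]) (auto simp: out_nbrs_def)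
  with assms(2,3) show False by (simp add: gamma_FA_eq)
qed


text \<open>
  If demand on \<open>(a, b)\<close> were left unserved, one could send a small flow \<open>\<epsilon>\<close> along it, taken from the
  carriers leaving at \<open>a\<close>, those who stay leaving at \<open>b\<close> instead. The payments on other lanes out of \<open>a\<close>
  rise by order \<open>\<epsilon>\<close>, while the new lane gains about \<open>- \<epsilon> * ln \<epsilon> / \<beta>\<close>, which is larger for small \<open>\<epsilon>\<close>.
\<close>

lemma optimal_flow_pos:
  fixes M :: "'n::finite market"
  assumes mkt: "freight_market M" and opt: "fluid_optimal M d y v" and v: "\<And>i. 0 < v i"
    and e: "(a, b) \<in> lanes M" and d: "0 < d (a, b)"
  shows "0 < y (a, b)"
proof (rule ccontr)
  assume "\<not> 0 < y (a, b)"
  moreover have feas: "fluid_feasible M d y v" using opt by (simp add: fluid_optimal_def)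
  ultimately have y0: "y (a, b) = 0" using e by (force simp: fluid_feasible_def)
  define \<beta> where "\<beta> = sensitivity M"
  have \<beta>: "0 < \<beta>" using mkt by (simp add: \<beta>_def freight_market_def)
  have q: "0 < stay_prob M (a, b)" using mkt e by (auto simp: freight_market_def)
  have y: "0 \<le> y e" if "e \<in> lanes M" for e using feas that by (simp add: fluid_feasible_def)
  (* C bounds the loss per unit of epsilon on the other lanes; ln epsilon < L makes the gain exceed it *)
  define C where "C = (\<Sum>e\<in>lanes M. 2 * y e / (\<beta> * v a))"
  define L where "L = \<beta> * (- C + penalty M (a, b)) - disutility M (a, b) - ln (2 / v a)"
  have "eventually (\<lambda>\<epsilon>. ln \<epsilon> < L) (at_right 0)"
    using ln_at_0 by (auto simp: filterlim_at_bot_dense)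
  moreover have "eventually (\<lambda>\<epsilon>. \<epsilon> \<in> {0<..<min (d (a, b)) (v a / 2)}) (at_right (0 :: real))"
    using d v[of a] by (intro eventually_at_right_real) auto
  ultimately have "eventually (\<lambda>\<epsilon>. ln \<epsilon> < L \<and> \<epsilon> \<in> {0<..<min (d (a, b)) (v a / 2)}) (at_right (0 :: real))"
    by (rule eventually_conj)
  then obtain \<epsilon> where \<epsilon>: "0 < \<epsilon>" "\<epsilon> < d (a, b)" "\<epsilon> < v a / 2" "ln \<epsilon> < L"
    by (auto dest: eventually_happens)
  define y' where "y' = y((a, b) := \<epsilon>)"
  define v' where "v' i = v i + (if i = b then stay_prob M (a, b) * \<epsilon> else 0) - (if i = a then \<epsilon> else 0)" for i
  have q\<epsilon>: "0 < stay_prob M (a, b) * \<epsilon>" using \<epsilon> q by simp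
  then have va: "v a / 2 \<le> v' a" using \<epsilon> by (auto simp: v'_def)
  have v'_pos: "0 < v' i" for i
    using v[of i] va q\<epsilon> by (cases "i = a") (auto simp: v'_def)
  have "fluid_feasible M d y' v'"
    unfolding fluid_feasible_def
  proof (intro conjI allI ballI)
    fix j
    have "(\<Sum>i\<in>in_nbrs M j. stay_prob M (i, j) * y' (i, j))
        = (\<Sum>i\<in>in_nbrs M j. stay_prob M (i, j) * y (i, j) + (if i = a then if j = b then stay_prob M (a, b) * \<epsilon> else 0 else 0))"
      using y0 by (intro sum.cong) (auto simp: y'_def)
    also have "\<dots> = (\<Sum>i\<in>in_nbrs M j. stay_prob M (i, j) * y (i, j)) + (if j = b then stay_prob M (a, b) * \<epsilon> else 0)"
      using e by (simp add: sum.distrib in_nbrs_def)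
    finally have inflow: "(\<Sum>i\<in>in_nbrs M j. stay_prob M (i, j) * y' (i, j))
      = (\<Sum>i\<in>in_nbrs M j. stay_prob M (i, j) * y (i, j)) + (if j = b then stay_prob M (a, b) * \<epsilon> else 0)" .
    have "(\<Sum>k\<in>out_nbrs M j. y' (j, k)) = (\<Sum>k\<in>out_nbrs M j. y (j, k) + (if k = b then if j = a then \<epsilon> else 0 else 0))"
      using y0 by (intro sum.cong) (auto simp: y'_def)
    also have "\<dots> = (\<Sum>k\<in>out_nbrs M j. y (j, k)) + (if j = a then \<epsilon> else 0)"
      using e by (simp add: sum.distrib out_nbrs_def)
    finally show "(\<Sum>i\<in>in_nbrs M j. stay_prob M (i, j) * y' (i, j)) + arrival_rate M j
        = (\<Sum>k\<in>out_nbrs M j. y' (j, k)) + v' j"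
      using feas inflow by (auto simp: fluid_feasible_def v'_def)
  next
    fix e' assume "e' \<in> lanes M"
    then show "d e' \<in> demand_range M e'" "0 \<le> y' e'" "y' e' \<le> d e'"
      using feas \<epsilon> by (auto simp: fluid_feasible_def y'_def)
  next
    show "0 \<le> v' i" for i using v'_pos[of i] by simp
  qed
  then have "fluid_objective M d y' v' \<le> fluid_objective M d y v"
    using opt by (simp add: fluid_optimal_def)
  then have le: "sum (lane_profit M d y' v') (lanes M) \<le> sum (lane_profit M d y v) (lanes M)"
    using v v'_pos by (simp add: fluid_objective_finite less_imp_neq[symmetric])
  have other: "lane_profit M d y v e' - 2 * y e' / (\<beta> * v a) * \<epsilon> \<le> lane_profit M d y' v' e'"
    if e': "e' \<in> lanes M" "e' \<noteq> (a, b)" for e'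
  proof -
    obtain i j where ij: "e' = (i, j)" by force
    show ?thesis
    proof (cases "y e' = 0")
      case True
      then show ?thesis using e' by (simp add: lane_profit_def y'_def)
    next
      case False
      then have ye: "0 < y e'" using y[OF e'(1)] by simp
      have "ln (v i) - ln (v' i) \<le> 2 * \<epsilon> / v a"
      proof (cases "i = a")
        case True
        have "ln (v a) - ln (v' a) = ln (v a / v' a)" using v[of a] v'_pos[of a] by (simp add: ln_div)
        also have "\<dots> \<le> v a / v' a - 1" using v[of a] v'_pos[of a] by (intro ln_le_minus_one) auto
        also have "\<dots> = (v a - v' a) / v' a" using v'_pos[of a] by (simp add: field_simps)
        also have "\<dots> \<le> \<epsilon> / v' a"
          using v'_pos[of a] \<epsilon> q by (intro divide_right_mono) (auto simp: v'_def)
        also have "\<dots> \<le> \<epsilon> / (v a / 2)"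
          using va v[of a] \<epsilon> by (intro divide_left_mono) auto
        finally show ?thesis using True by (simp add: mult.commute)
      next
        case False
        then have "v i \<le> v' i" using q \<epsilon> by (simp add: v'_def)
        then have "ln (v i) - ln (v' i) \<le> 0" using v[of i] v'_pos[of i] by simp
        also have "0 \<le> 2 * \<epsilon> / v a" using \<epsilon> v[of a] by simp
        finally show ?thesis .
      qed
      moreover have "lane_profit M d y v e' - lane_profit M d y' v' e' = y e' / \<beta> * (ln (v i) - ln (v' i))"
      proof -
        have "y' (i, j) = y (i, j)" using e' by (auto simp: y'_def ij)
        then have "lane_profit M d y v e' - lane_profit M d y' v' e'
            = y e' / \<beta> * (ln (y e' / v' i) - ln (y e' / v i))"
          using \<beta> by (simp add: lane_profit_def fluid_carrier_price_def ij \<beta>_def[symmetric] field_simps)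
        moreover have "ln (y e' / v' i) - ln (y e' / v i) = ln (v i) - ln (v' i)"
          using ye v[of i] v'_pos[of i] by (simp add: ln_div)
        ultimately show ?thesis by simp
      qed
      ultimately have "lane_profit M d y v e' - lane_profit M d y' v' e' \<le> y e' / \<beta> * (2 * \<epsilon> / v a)"
        using ye \<beta> mult_left_mono[of "ln (v i) - ln (v' i)" "2 * \<epsilon> / v a" "y e' / \<beta>"]
        by (simp del: times_divide_eq_left times_divide_eq_right)
      then show ?thesis by (simp add: algebra_simps)
    qed
  qed
  have new: "lane_profit M d y v (a, b) + C * \<epsilon> < lane_profit M d y' v' (a, b)"
  proof -
    have "lane_profit M d y' v' (a, b) - lane_profit M d y v (a, b)
        = \<epsilon> * (penalty M (a, b) - (ln (\<epsilon> / v' a) + disutility M (a, b)) / \<beta>)"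
      by (simp add: lane_profit_def y'_def y0 fluid_carrier_price_def \<beta>_def algebra_simps add_divide_distrib)
    moreover have "C < penalty M (a, b) - (ln (\<epsilon> / v' a) + disutility M (a, b)) / \<beta>"
    proof -
      have "ln (\<epsilon> / v' a) \<le> ln (\<epsilon> * (2 / v a))"
        using va v[of a] v'_pos[of a] \<epsilon> by (auto simp: field_simps)
      also have "\<dots> = ln \<epsilon> + ln (2 / v a)" using \<epsilon> v[of a] by (intro ln_mult_pos) auto
      also have "\<dots> < L + ln (2 / v a)" using \<epsilon> by simp
      finally have "ln (\<epsilon> / v' a) + disutility M (a, b) < (penalty M (a, b) - C) * \<beta>"
        by (simp add: L_def algebra_simps)
      then have "(ln (\<epsilon> / v' a) + disutility M (a, b)) / \<beta> < penalty M (a, b) - C"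
        using \<beta> by (simp add: pos_divide_less_eq)
      then show ?thesis by simp
    qed
    ultimately show ?thesis
      using mult_strict_left_mono[OF _ \<epsilon>(1)] by (smt (verit) mult.commute)
  qed
  have "sum (lane_profit M d y v) (lanes M)
      = lane_profit M d y v (a, b) + sum (lane_profit M d y v) (lanes M - {(a, b)})"
    using e by (simp add: sum.remove)
  also have "\<dots> < (lane_profit M d y' v' (a, b) - C * \<epsilon>) + sum (lane_profit M d y v) (lanes M - {(a, b)})"
    using new by simp
  also have "sum (lane_profit M d y v) (lanes M - {(a, b)})
      \<le> (\<Sum>e'\<in>lanes M - {(a, b)}. lane_profit M d y' v' e' + 2 * y e' / (\<beta> * v a) * \<epsilon>)"
    using other by (intro sum_mono) (auto simp: algebra_simps)
  also have "\<dots> = sum (lane_profit M d y' v') (lanes M - {(a, b)}) + C * \<epsilon>"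
    using e y0 by (simp add: sum.distrib C_def sum_distrib_right sum.remove[of "lanes M" "(a, b)"])
  finally have "sum (lane_profit M d y v) (lanes M) < sum (lane_profit M d y' v') (lanes M)"
    using e by (simp add: sum.remove[of "lanes M" "(a, b)"])
  with le show False by simp
qed

lemma fluid_solution_of_optimal:
  fixes M :: "'n::finite market"
  assumes mkt: "freight_market M" and opt: "fluid_optimal M d y v" and pos: "0 < gamma_FA M"
  shows "fluid_solution M d y v"
proof -
  have feas: "fluid_feasible M d y v" using opt by (simp add: fluid_optimal_def)
  note v = optimal_outflow_pos[OF mkt opt pos]
  show ?thesis
  proof
    show "0 < y e" if "e \<in> lanes M" "0 < d e" for e
      using that optimal_flow_pos[OF mkt opt v] by (cases e) auto
    show "demand M e (SP_shipper_price M d e) = d e" if e: "e \<in> lanes M" for e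
    proof -
      have "inj_on (demand M e) (prices M e)"
      proof (rule inj_onI, rule ccontr)
        have anti: "strict_antimono_on (prices M e) (demand M e)"
          using mkt e unfolding freight_market_def by blast
        fix r s assume rs: "r \<in> prices M e" "s \<in> prices M e" "demand M e r = demand M e s" "r \<noteq> s"
        then consider "r < s" | "s < r" by linarith
        then show False
          using monotone_onD[OF anti rs(1,2)] monotone_onD[OF anti rs(2,1)] rs(3) by cases auto
      qed
      moreover have "d e \<in> demand M e ` prices M e"
        using feas e by (auto simp: fluid_feasible_def demand_range_def)
      ultimately show ?thesis
        unfolding SP_shipper_price_def inverse_demand_def by (rule f_the_inv_into_f)
    qed
  qed (use mkt feas v in \<open>auto simp: freight_market_def fluid_feasible_def\<close>)
qed

section \<open>Asymptotic optimality\<close>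

theorem theorem2:
  fixes M :: "'n::finite market"
    and d y :: "'n \<times> 'n \<Rightarrow> real"
    and v :: "'n \<Rightarrow> real"
  assumes "freight_market M"
    and "fluid_optimal M d y v"
    and "0 < gamma_FA M"
  shows "(\<forall>\<theta>\<ge>1. \<forall>x. SP_average_profit M d y v \<theta> x \<longlonglongrightarrow> gamma_SP M d y v \<theta>) \<and>
    (\<exists>K. \<forall>\<theta>\<ge>1. gamma_FA (scale \<theta> M) - gamma_SP M d y v \<theta> \<le> K * sqrt (real \<theta>)) \<and>
    (\<lambda>\<theta>. 1 - gamma_SP M d y v \<theta> / gamma_FA (scale \<theta> M)) \<in> O(\<lambda>\<theta>. 1 / sqrt (real \<theta>)) \<and>
    (\<lambda>\<theta>. gamma_SP M d y v \<theta> / gamma_FA (scale \<theta> M)) \<longlonglongrightarrow> 1"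
proof -
  interpret fluid_solution M d y v by (rule fluid_solution_of_optimal[OF assms])
  define K where "K = margin_const * (gap_const / (1 - max_stay) + booking_const)"
  have fluid_value: "gamma_FA M = fluid_profit"
    using outflow_pos
    by (simp add: gamma_FA_eq[OF assms(2)] fluid_objective_finite less_imp_neq[symmetric]
          fluid_profit_def lane_profit_def[abs_def] SP_shipper_price_def)
  have dev: "\<bar>gamma_FA (scale \<theta> M) - gamma_SP M d y v \<theta>\<bar> \<le> K * sqrt (real \<theta>)" if "1 \<le> \<theta>" for \<theta>
    using long_run_profit_deviation[OF that]
    by (simp add: gamma_FA_scale[OF assms(2) that] fluid_value K_def abs_minus_commute)
  have rate: "norm (1 - gamma_SP M d y v \<theta> / gamma_FA (scale \<theta> M))
      \<le> K / gamma_FA M * norm (1 / sqrt (real \<theta>))" if \<theta>: "1 \<le> \<theta>" for \<theta>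
  proof -
    have g: "gamma_FA (scale \<theta> M) = real \<theta> * gamma_FA M" by (rule gamma_FA_scale[OF assms(2) \<theta>])
    have "1 - gamma_SP M d y v \<theta> / gamma_FA (scale \<theta> M)
        = (gamma_FA (scale \<theta> M) - gamma_SP M d y v \<theta>) / (real \<theta> * gamma_FA M)"
      using \<theta> assms(3) by (simp add: g diff_divide_distrib)
    then have "norm (1 - gamma_SP M d y v \<theta> / gamma_FA (scale \<theta> M))
        = \<bar>gamma_FA (scale \<theta> M) - gamma_SP M d y v \<theta>\<bar> / (real \<theta> * gamma_FA M)"
      using \<theta> assms(3) by simp
    also have "\<dots> \<le> K * sqrt (real \<theta>) / (real \<theta> * gamma_FA M)"
      using dev[OF \<theta>] assms(3) by (intro divide_right_mono) auto
    also have "\<dots> = K / gamma_FA M * norm (1 / sqrt (real \<theta>))"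
    proof -
      have "real \<theta> = sqrt (real \<theta>) * sqrt (real \<theta>)" by simp
      then show ?thesis using \<theta> assms(3) by (simp add: divide_simps)
    qed
    finally show ?thesis .
  qed
  then have rate_ev: "eventually (\<lambda>\<theta>. norm (1 - gamma_SP M d y v \<theta> / gamma_FA (scale \<theta> M))
      \<le> K / gamma_FA M * norm (1 / sqrt (real \<theta>))) sequentially"
    using eventually_ge_at_top[of 1] by (rule eventually_mono[rotated])
  then have bigo: "(\<lambda>\<theta>. 1 - gamma_SP M d y v \<theta> / gamma_FA (scale \<theta> M)) \<in> O(\<lambda>\<theta>. 1 / sqrt (real \<theta>))"
    by (rule bigoI)
  have "(\<lambda>\<theta>. 1 / sqrt (real \<theta>)) \<longlonglongrightarrow> 0"
    by (intro tendsto_divide_0[OF tendsto_const] filterlim_at_top_imp_at_infinity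
          filterlim_compose[OF sqrt_at_top filterlim_real_sequentially])
  then have "(\<lambda>\<theta>. K / gamma_FA M * norm (1 / sqrt (real \<theta>))) \<longlonglongrightarrow> 0"
    by (intro tendsto_mult_right_zero tendsto_norm_zero)
  with rate_ev have "(\<lambda>\<theta>. 1 - gamma_SP M d y v \<theta> / gamma_FA (scale \<theta> M)) \<longlonglongrightarrow> 0"
    by (rule Lim_null_comparison)
  from tendsto_diff[OF tendsto_const[of 1] this]
  have "(\<lambda>\<theta>. gamma_SP M d y v \<theta> / gamma_FA (scale \<theta> M)) \<longlonglongrightarrow> 1" by simp
  moreover have "gamma_FA (scale \<theta> M) - gamma_SP M d y v \<theta> \<le> K * sqrt (real \<theta>)" if "1 \<le> \<theta>" for \<theta>
    using dev[OF that] by linarith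
  ultimately show ?thesis using bigo SP_average_profit_limit by blast
qed

end
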